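(* Let $X$ be a rearrangement invariant space of complex valued functions on $\mathbb R^n$ and let $w$ be a non-negative measurable function on $\mathbb R^n$ that is not almost everywhere zero. Suppose there exists a $C>0$ such that, whenever $f$ is integrable and $wf\in X$, we have $w\widehat f\in X$ and \[ \|w\widehat f\|_X\le C\|wf\|_X. \] Then there exist positive real numbers $m$ and $M$ such that $m\le w(x)\le M$ for almost every $x\in\mathbb R^n$. Moreover, $X=L^2(\mathbb R^n)$ with equivalent norms.
   Context: The Fourier transform of an integrable $f\colon\mathbb R^n\to\mathbb C$ is $\widehat f(x)=\int_{\mathbb R^n}e^{-2\pi i x\cdot t}f(t)\,dt$. A rearrangement invariant space $X$ (in the sense of Bennett–Sharpley) is defined by a norm $\rho$ on non-negative measurable functions on $\mathbb R^n$ such that: $\rho(f)=0$ iff $f=0$ a.e., $\rho(af)=a\rho(f)$ for $a\ge0$, $\rho(f+g)\le\rho(f)+\rho(g)$; $0\le g\le f$ a.e. implies $\rho(g)\le\rho(f)$; $0\le f_k\uparrow f$ a.e. implies $\rho(f_k)\uparrow\rho(f)$; $\rho(\chi_E)<\infty$ for every set $E$ of finite measure; for every $E$ of finite measure there is $C_E$ with $\int_E f\le C_E\rho(f)$; and $\rho(f)=\rho(g)$ whenever $f,g$ are equimeasurable (i.e. $|\{|f|>\lambda\}|=|\{|g|>\lambda\}|$ for all $\lambda>0$). Then $X=\{f \text{ measurable}:\|f\|_X:=\rho(|f|)<\infty\}$. "$X=L^2$ with equivalent norms" means the sets coincide and the norms are equivalent. *)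

theory Defs
  imports "HOL-Analysis.Analysis"
begin

definition fourier :: "('a::euclidean_space \<Rightarrow> complex) \<Rightarrow> 'a \<Rightarrow> complex" where
  "fourier f x = (LINT t|lebesgue. cis (- 2 * pi * (x \<bullet> t)) * f t)"

text \<open>Bennett--Sharpley rearrangement invariant function norm rho, acting on
  non-negative (extended real valued) Lebesgue measurable functions.\<close>
definition ri_norm :: "(('a::euclidean_space \<Rightarrow> ennreal) \<Rightarrow> ennreal) \<Rightarrow> bool" where
  "ri_norm \<rho> \<longleftrightarrow>
    (\<forall>f \<in> borel_measurable lebesgue. \<rho> f = 0 \<longleftrightarrow> (AE x in lebesgue. f x = 0)) \<and>
    (\<forall>f \<in> borel_measurable lebesgue. \<forall>a::real. a \<ge> 0 \<longrightarrow>
        \<rho> (\<lambda>x. ennreal a * f x) = ennreal a * \<rho> f) \<and>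
    (\<forall>f \<in> borel_measurable lebesgue. \<forall>g \<in> borel_measurable lebesgue.
        \<rho> (\<lambda>x. f x + g x) \<le> \<rho> f + \<rho> g) \<and>
    (\<forall>f \<in> borel_measurable lebesgue. \<forall>g \<in> borel_measurable lebesgue.
        (AE x in lebesgue. g x \<le> f x) \<longrightarrow> \<rho> g \<le> \<rho> f) \<and>
    (\<forall>F f. (\<forall>k. F k \<in> borel_measurable lebesgue) \<longrightarrow> f \<in> borel_measurable lebesgue \<longrightarrow>
        (AE x in lebesgue. incseq (\<lambda>k. F k x) \<and> (SUP k. F k x) = f x) \<longrightarrow>
        incseq (\<lambda>k. \<rho> (F k)) \<and> (SUP k. \<rho> (F k)) = \<rho> f) \<and>
    (\<forall>E \<in> sets lebesgue. emeasure lebesgue E < \<infinity> \<longrightarrow> \<rho> (indicator E) < \<infinity>) \<and>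
    (\<forall>E \<in> sets lebesgue. emeasure lebesgue E < \<infinity> \<longrightarrow>
        (\<exists>C::real. \<forall>f \<in> borel_measurable lebesgue.
            (\<integral>\<^sup>+ x \<in> E. f x \<partial>lebesgue) \<le> ennreal C * \<rho> f)) \<and>
    (\<forall>f \<in> borel_measurable lebesgue. \<forall>g \<in> borel_measurable lebesgue.
        (\<forall>t::real. t > 0 \<longrightarrow>
           emeasure lebesgue {x. f x > ennreal t} = emeasure lebesgue {x. g x > ennreal t})
        \<longrightarrow> \<rho> f = \<rho> g)"

definition ri_fnorm :: "(('a::euclidean_space \<Rightarrow> ennreal) \<Rightarrow> ennreal) \<Rightarrow> ('a \<Rightarrow> complex) \<Rightarrow> ennreal" where
  "ri_fnorm \<rho> f = \<rho> (\<lambda>x. ennreal (cmod (f x)))"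

definition ri_space :: "(('a::euclidean_space \<Rightarrow> ennreal) \<Rightarrow> ennreal) \<Rightarrow> ('a \<Rightarrow> complex) set" where
  "ri_space \<rho> = {f. f \<in> borel_measurable lebesgue \<and> ri_fnorm \<rho> f < \<infinity>}"

definition L2_space :: "('a::euclidean_space \<Rightarrow> complex) set" where
  "L2_space = {f. f \<in> borel_measurable lebesgue \<and> integrable lebesgue (\<lambda>x. (cmod (f x))^2)}"

definition L2_norm :: "('a::euclidean_space \<Rightarrow> complex) \<Rightarrow> real" where
  "L2_norm f = sqrt (LINT x|lebesgue. (cmod (f x))^2)"

end

theory Submission
  imports Defs
begin

text \<open>Translating and modulating \<open>f\<close> moves the two weights in the inequality independently. Testing it on indicators
  of balls at the dual scales \<open>d\<close> and \<open>1/(6d)\<close> in turn compares the weight on any two small balls of radius \<open>d\<close>,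
  which bounds the essential supremum of \<open>w\<close> by a multiple of its essential infimum. So one may take \<open>w = 1\<close>.

  Changing signs of the pieces of a step function \<open>f\<close> with values \<open>a\<^sub>j\<close> on disjoint sets \<open>E\<^sub>j\<close> of measure \<open>t\<close> does not change its norm, and
  on average over the signs its transform is at least \<open>c t (\<Sum> a\<^sub>j\<^sup>2)\<^bsup>1/2\<^esup>\<close> on a ball of volume about \<open>1/t\<close>.
  This forces the fundamental function of \<open>X\<close> to be comparable to \<open>t\<^bsup>1/2\<^esup>\<close> and bounds the \<open>L\<^sup>2\<close> norm
  of \<open>f\<close> by its norm in \<open>X\<close>. For the converse one applies the inequality to random trigonometric polynomials
  on a ball: their norm in \<open>X\<close> is controlled by second and fourth moments, while the average modulus of their
  transforms dominates a multiple of \<open>f\<close>.\<close>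

section \<open>Random signs\<close>

text \<open>Norms in \<open>X\<close> see only the sizes of level sets, so the pieces of a step
  function may be replaced by disjoint balls of radius \<open>d\<close> placed anywhere. The
  transform of the indicator of such a ball has modulus at least half its volume on the ball of
  radius \<open>1 / (6 * d)\<close> about the origin, whatever the centre; modulation moves that
  second ball. The 6 keeps the phase within \<pi>/3. Since only this lower bound on moduli is known,
  cancellation between pieces is the obstacle, and random signs remove it.

  In the converse direction the fundamental function controls norms of indicators only. A random
  polynomial therefore has to be cut into dyadic layers. With second moments alone each layer would
  get the same bound, and the number of layers is not under control; with fourth moments the bounds
  decay geometrically. Moreover, the resulting estimate has to be linear in the moment, because the
  average over signs is taken outside the norm.\<close>

definition signed_sum :: "('i \<Rightarrow> complex) \<Rightarrow> 'i set \<Rightarrow> 'i set \<Rightarrow> complex" where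
  "signed_sum b J T = (\<Sum>j\<in>J. if j \<in> T then b j else - b j)"

text \<open>Signs are encoded by the set \<open>T\<close> of indices that keep their sign, so an
  expectation is a sum over \<open>Pow J\<close> normalised by \<open>2 ^ card J\<close>. Pairing
  \<open>T\<close> with \<open>insert k T\<close> peels off one sign and drives the inductions
  below.\<close>

lemma sum_Pow_signed_sum_insert:
  fixes G :: "complex \<Rightarrow> real"
  assumes "finite J" "k \<notin> J"
  shows "(\<Sum>T\<in>Pow (insert k J). G (signed_sum b (insert k J) T)) =
    (\<Sum>T\<in>Pow J. G (signed_sum b J T + b k) + G (signed_sum b J T - b k))"
proof -
  have inj: "inj_on (insert k) (Pow J)" using assms(2) by (auto simp: inj_on_def)
  have disj: "Pow J \<inter> insert k ` Pow J = {}" using assms(2) by auto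
  have 1: "signed_sum b (insert k J) T = signed_sum b J T - b k" if "T \<in> Pow J" for T
    using that assms by (auto simp: signed_sum_def)
  have 2: "signed_sum b (insert k J) (insert k T) = signed_sum b J T + b k" if "T \<in> Pow J" for T
  proof -
    have "(\<Sum>j\<in>J. if j \<in> insert k T then b j else - b j) = (\<Sum>j\<in>J. if j \<in> T then b j else - b j)"
      using assms by (intro sum.cong) auto
    then show ?thesis using assms by (simp add: signed_sum_def)
  qed
  show ?thesis
    unfolding Pow_insert
    by (subst sum.union_disjoint) (use assms disj 1 2 in
      \<open>auto simp: sum.reindex[OF inj] sum.distrib add.commute intro!: arg_cong2[of _ _ _ _ "(+)"]\<close>)
qed

lemma cmod_add_diff_power2: "(cmod (s + b))\<^sup>2 + (cmod (s - b))\<^sup>2 = 2 * ((cmod s)\<^sup>2 + (cmod b)\<^sup>2)"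
  unfolding power2_norm_eq_inner by (simp add: algebra_simps inner_commute)

text \<open>With P the sum of the two squared moduli, the left side is (P + c)^2 + (P - c)^2 = 2 P^2
  + 2 c^2, and Cauchy-Schwarz bounds c^2.\<close>

lemma cmod_add_diff_power4:
  "(cmod (s + b))^4 + (cmod (s - b))^4 \<le> 2 * ((cmod s)^4 + 6 * (cmod s)\<^sup>2 * (cmod b)\<^sup>2 + (cmod b)^4)"
proof -
  define c where "c = 2 * (s \<bullet> b)"
  have "(cmod (s + b))\<^sup>2 = (cmod s)\<^sup>2 + (cmod b)\<^sup>2 + c"
    "(cmod (s - b))\<^sup>2 = (cmod s)\<^sup>2 + (cmod b)\<^sup>2 - c"
    unfolding power2_norm_eq_inner c_def by (auto simp: algebra_simps inner_commute)
  moreover have "x^4 = (x\<^sup>2)\<^sup>2" for x :: real by simp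
  moreover have "c\<^sup>2 \<le> 4 * ((cmod s)\<^sup>2 * (cmod b)\<^sup>2)"
  proof -
    have "\<bar>c\<bar> \<le> 2 * (cmod s * cmod b)"
      unfolding c_def using Cauchy_Schwarz_ineq2[of s b] by (simp add: abs_mult)
    then have "\<bar>c\<bar>\<^sup>2 \<le> (2 * (cmod s * cmod b))\<^sup>2" by (intro power_mono) auto
    then show ?thesis by (simp add: power_mult_distrib)
  qed
  ultimately show ?thesis
    by (simp only:) (simp add: power2_eq_square algebra_simps)
qed

lemma signed_sum_second_moment:
  assumes "finite J"
  shows "(\<Sum>T\<in>Pow J. (cmod (signed_sum b J T))\<^sup>2) = 2 ^ card J * (\<Sum>j\<in>J. (cmod (b j))\<^sup>2)"
  using assms
proof induction
  case (insert k J)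
  have "(\<Sum>T\<in>Pow (insert k J). (cmod (signed_sum b (insert k J) T))\<^sup>2)
    = (\<Sum>T\<in>Pow J. 2 * (cmod (signed_sum b J T))\<^sup>2 + 2 * (cmod (b k))\<^sup>2)"
    unfolding sum_Pow_signed_sum_insert[where G="\<lambda>z. (cmod z)\<^sup>2", OF insert.hyps] cmod_add_diff_power2
    by (simp add: distrib_left)
  also have "\<dots> = 2 * (2 ^ card J * (\<Sum>j\<in>J. (cmod (b j))\<^sup>2)) + 2 ^ card J * (2 * (cmod (b k))\<^sup>2)"
    using insert by (simp add: sum.distrib sum_distrib_left[symmetric] card_Pow)
  finally show ?case using insert.hyps by (simp add: algebra_simps)
qed (simp add: signed_sum_def)

lemma signed_sum_fourth_moment:
  assumes "finite J"
  shows "(\<Sum>T\<in>Pow J. (cmod (signed_sum b J T))^4) \<le> 2 ^ card J * (3 * (\<Sum>j\<in>J. (cmod (b j))\<^sup>2)\<^sup>2)"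
  using assms
proof induction
  case (insert k J)
  define A where "A = (\<Sum>j\<in>J. (cmod (b j))\<^sup>2)"
  define B where "B = (cmod (b k))\<^sup>2"
  have B4: "(cmod (b k))^4 = B\<^sup>2" by (simp add: B_def)
  have "(\<Sum>T\<in>Pow (insert k J). (cmod (signed_sum b (insert k J) T))^4)
    \<le> (\<Sum>T\<in>Pow J. 2 * (cmod (signed_sum b J T))^4 + (12 * B) * (cmod (signed_sum b J T))\<^sup>2 + 2 * B\<^sup>2)"
    using insert.hyps unfolding sum_Pow_signed_sum_insert[where G="\<lambda>z. (cmod z)^4", OF insert.hyps] B4[symmetric] B_def
    by (intro sum_mono order.trans[OF cmod_add_diff_power4]) (simp add: algebra_simps)
  also have "\<dots> = 2 * (\<Sum>T\<in>Pow J. (cmod (signed_sum b J T))^4) + (12 * B) * (2 ^ card J * A) + 2 ^ card J * (2 * B\<^sup>2)"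
    using insert.hyps unfolding A_def
    by (simp only: sum.distrib sum_distrib_left[symmetric] signed_sum_second_moment[OF insert.hyps(1)])
       (simp add: card_Pow)
  \<comment> \<open>Raising \<open>2 * B\<^sup>2\<close> to \<open>6 * B\<^sup>2\<close> completes
    the square \<open>6 * (B + A)\<^sup>2\<close>.\<close>
  also have "\<dots> \<le> 2 * (2 ^ card J * (3 * A\<^sup>2)) + (12 * B) * (2 ^ card J * A) + 2 ^ card J * (6 * B\<^sup>2)"
    using insert.IH unfolding A_def B_def by (intro add_mono mult_left_mono) auto
  also have "\<dots> = 2 ^ card (insert k J) * (3 * (B + A)\<^sup>2)"
    using insert.hyps by (simp add: power2_eq_square algebra_simps)
  finally show ?case using insert.hyps by (simp add: A_def B_def)
qed (simp add: signed_sum_def)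

text \<open>The sums with \<open>k\<close> inside and outside \<open>T\<close> differ by
  \<open>2 * b k\<close>, so the triangle inequality bounds each pair from below. This serves where
  a single term is known to be large; \<open>khintchine_first_moment\<close> serves where all terms
  are.\<close>

lemma signed_sum_first_moment_ge_term:
  assumes "finite J" "k \<in> J"
  shows "2 ^ card J * cmod (b k) \<le> (\<Sum>T\<in>Pow J. cmod (signed_sum b J T))"
proof -
  define I where "I = J - {k}"
  have J: "J = insert k I" "k \<notin> I" "finite I" using assms by (auto simp: I_def)
  have "2 * cmod (b k) \<le> cmod (signed_sum b I T + b k) + cmod (signed_sum b I T - b k)" for T
    using norm_triangle_ineq4[of "signed_sum b I T + b k" "signed_sum b I T - b k"] by (simp add: norm_mult)
  then have "(\<Sum>T\<in>Pow I. 2 * cmod (b k)) \<le> (\<Sum>T\<in>Pow J. cmod (signed_sum b J T))"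
    unfolding J(1) sum_Pow_signed_sum_insert[where G=cmod, OF J(3,2)] by (intro sum_mono)
  then show ?thesis using J by (simp add: card_Pow)
qed

text \<open>After normalising \<open>A\<close> to 1, the pointwise inequality
  \<open>u\<^sup>2 - u^4/6 \<le> u\<close> bounds the first moment by the second and fourth. The
  weight 1/6 turns the fourth moment, at most 3, into a loss of 1/2.\<close>

lemma khintchine_first_moment:
  assumes "finite J"
  shows "2 ^ card J * (sqrt (\<Sum>j\<in>J. (cmod (b j))\<^sup>2) / 2) \<le> (\<Sum>T\<in>Pow J. cmod (signed_sum b J T))"
proof (cases "(\<Sum>j\<in>J. (cmod (b j))\<^sup>2) = 0")
  case True
  then show ?thesis by (simp add: sum_nonneg)
next
  case False
  define A where "A = sqrt (\<Sum>j\<in>J. (cmod (b j))\<^sup>2)"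
  have A2: "A\<^sup>2 = (\<Sum>j\<in>J. (cmod (b j))\<^sup>2)" by (simp add: A_def sum_nonneg)
  have A: "A > 0" using False by (simp add: A_def less_le sum_nonneg)
  have scal: "u\<^sup>2 - u^4/6 \<le> u" if "u \<ge> 0" for u :: real
  proof -
    have "u - u^3/6 \<le> 1"
    proof -
      \<comment> \<open>On \<open>u \<ge> 0\<close> the function \<open>u - 4/27 * u^3\<close> has
        its maximum 1 at 3/2, and 4/27 is below 1/6.\<close>
      have "0 \<le> (u - 3/2)\<^sup>2 * (u + 3)" using that by simp
      also have "\<dots> = u^3 - 27/4 * u + 27/4" by (simp add: power2_eq_square power3_eq_cube field_simps)
      finally show ?thesis using zero_le_power[OF that, of 3] by linarith
    qed
    then have "u * (u - u^3/6) \<le> u * 1" using that by (intro mult_left_mono)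
    then show ?thesis by (simp add: power2_eq_square power3_eq_cube power4_eq_xxxx algebra_simps)
  qed
  have pt: "A\<^sup>2 * u\<^sup>2 - u^4/6 \<le> A^3 * u" if "u \<ge> 0" for u :: real
  proof -
    have "(u/A)\<^sup>2 - (u/A)^4/6 \<le> u/A" using that A by (intro scal) auto
    then have "A^4 * ((u/A)\<^sup>2 - (u/A)^4/6) \<le> A^4 * (u/A)" using A by (intro mult_left_mono) auto
    moreover have "A^4 * ((u/A)\<^sup>2 - (u/A)^4/6) = A\<^sup>2 * u\<^sup>2 - u^4/6" "A^4 * (u/A) = A^3 * u"
      using A by (auto simp: power2_eq_square power3_eq_cube power4_eq_xxxx field_simps)
    ultimately show ?thesis by simp
  qed
  have "2 ^ card J * (A^4 / 2) = A\<^sup>2 * (2 ^ card J * A\<^sup>2) - (2 ^ card J * (3 * (A\<^sup>2)\<^sup>2))/6"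
    by (simp add: power2_eq_square power4_eq_xxxx)
  also have "\<dots> \<le> A\<^sup>2 * (\<Sum>T\<in>Pow J. (cmod (signed_sum b J T))\<^sup>2) - (\<Sum>T\<in>Pow J. (cmod (signed_sum b J T))^4)/6"
    using signed_sum_fourth_moment[OF assms, of b] unfolding signed_sum_second_moment[OF assms] A2 by simp
  also have "\<dots> = (\<Sum>T\<in>Pow J. A\<^sup>2 * (cmod (signed_sum b J T))\<^sup>2 - (cmod (signed_sum b J T))^4/6)"
    by (simp add: sum_subtractf sum_distrib_left sum_divide_distrib)
  also have "\<dots> \<le> (\<Sum>T\<in>Pow J. A^3 * cmod (signed_sum b J T))"
    by (intro sum_mono pt) auto
  also have "\<dots> = A^3 * (\<Sum>T\<in>Pow J. cmod (signed_sum b J T))" by (simp add: sum_distrib_left)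
  finally have "A^3 * (2 ^ card J * (A / 2)) \<le> A^3 * (\<Sum>T\<in>Pow J. cmod (signed_sum b J T))"
    by (simp add: power3_eq_cube power4_eq_xxxx mult_ac)
  then show ?thesis using A by (simp add: A_def[symmetric])
qed

section \<open>Fourier transforms of indicators and density of small balls\<close>

lemma emeasure_lebesgue_ball:
  fixes y :: "'a::euclidean_space"
  assumes "r \<ge> 0"
  shows "emeasure lebesgue (ball y r) = ennreal (unit_ball_vol DIM('a) * r ^ DIM('a))"
  using emeasure_ball[OF assms, of y] by (simp add: emeasure_completion)

lemma borel_measurable_lebesgue_inner [measurable]:
  "(\<lambda>t. z \<bullet> t) \<in> borel_measurable (lebesgue :: 'a::euclidean_space measure)"
  by (intro measurable_completion) measurable

lemma borel_measurable_cis [measurable (raw)]: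
  "f \<in> borel_measurable M \<Longrightarrow> (\<lambda>x. cis (f x)) \<in> borel_measurable M"
  by (rule borel_measurable_continuous_on[of cis]) (auto intro!: continuous_intros)

lemma continuous_on_fourier:
  fixes f :: "'a::euclidean_space \<Rightarrow> complex"
  assumes f: "integrable lebesgue f"
  shows "continuous_on UNIV (fourier f)"
proof (intro continuous_at_imp_continuous_on ballI continuous_at_sequentiallyI)
  fix x :: 'a and X :: "nat \<Rightarrow> 'a"
  assume X: "X \<longlonglongrightarrow> x"
  have [measurable]: "f \<in> borel_measurable lebesgue" using f by auto
  show "(\<lambda>n. fourier f (X n)) \<longlonglongrightarrow> fourier f x"
    unfolding fourier_def
  proof (rule integral_dominated_convergence)
    show "integrable lebesgue (\<lambda>t. cmod (f t))" using f by simp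
    show "AE t in lebesgue. (\<lambda>n. cis (- 2 * pi * (X n \<bullet> t)) * f t) \<longlonglongrightarrow> cis (- 2 * pi * (x \<bullet> t)) * f t"
      by (intro AE_I2 tendsto_intros X)
    show "AE t in lebesgue. cmod (cis (- 2 * pi * (X n \<bullet> t)) * f t) \<le> cmod (f t)" for n
      by (simp add: norm_mult)
  qed measurable
qed

lemma borel_measurable_fourier [measurable]:
  fixes f :: "'a::euclidean_space \<Rightarrow> complex"
  assumes "integrable lebesgue f"
  shows "fourier f \<in> borel_measurable lebesgue"
  using borel_measurable_continuous_onI[OF continuous_on_fourier[OF assms]]
  by (intro measurable_completion) simp

lemma integrable_bounded_on_finite_measure:
  fixes f :: "'a \<Rightarrow> complex"
  assumes "E \<in> sets M" "emeasure M E < \<infinity>" "f \<in> borel_measurable M"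
    and "\<And>x. cmod (f x) \<le> B * indicator E x"
  shows "integrable M f"
  by (rule Bochner_Integration.integrable_bound[where f="\<lambda>x. B * indicator E x"])
     (use assms in \<open>auto intro!: AE_I2 intro: order.trans[OF _ abs_ge_self]\<close>)

lemma fourier_sum:
  assumes "\<And>j. j \<in> J \<Longrightarrow> integrable lebesgue (f j)"
  shows "fourier (\<lambda>t. \<Sum>j\<in>J. f j t) x = (\<Sum>j\<in>J. fourier (f j) x)"
  unfolding fourier_def sum_distrib_left
proof (rule Bochner_Integration.integral_sum)
  fix j assume "j \<in> J"
  then have f: "integrable lebesgue (f j)" by (rule assms)
  then have [measurable]: "f j \<in> borel_measurable lebesgue" by auto
  show "integrable lebesgue (\<lambda>t. cis (- 2 * pi * (x \<bullet> t)) * f j t)"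
    by (rule Bochner_Integration.integrable_bound[OF f]) (auto simp: norm_mult)
qed

lemma fourier_cmult: "fourier (\<lambda>t. c * f t) x = c * fourier f x"
proof -
  have "fourier (\<lambda>t. c * f t) x = (LINT t|lebesgue. c * (cis (- 2 * pi * (x \<bullet> t)) * f t))"
    unfolding fourier_def by (intro Bochner_Integration.integral_cong) auto
  then show ?thesis by (simp add: fourier_def)
qed

text \<open>After removing the phase at the centre of the ball, the integrand has argument at most
  \<open>\<pi>/3\<close> in modulus, so its real part is at least \<open>1/2\<close>.\<close>

lemma fourier_modulated_indicator_ge:
  fixes E :: "'a::euclidean_space set"
  assumes E: "E \<in> sets lebesgue" "E \<subseteq> ball y r" and x: "norm (x - z) * r \<le> 1 / 6"
  shows "measure lebesgue E / 2 \<le> cmod (fourier (\<lambda>t. indicator E t * cis (2 * pi * (z \<bullet> t))) x)"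
proof (cases "r \<ge> 0")
  case True
  define c where "c t = cis (2 * pi * ((z - x) \<bullet> (t - y)))" for t
  have Efin: "emeasure lebesgue E < \<infinity>"
    using emeasure_mono[OF E(2), of lebesgue] emeasure_lebesgue_ball[OF True, of y]
    by (auto simp: less_top[symmetric] top_unique)
  have [measurable]: "E \<in> sets lebesgue" by fact
  have [measurable]: "c \<in> borel_measurable lebesgue" unfolding c_def inner_diff_right
    by measurable
  have "(\<lambda>t. indicator E t * c t) \<in> borel_measurable lebesgue" by measurable
  then have int: "integrable lebesgue (\<lambda>t. indicator E t * c t)"
    by (intro integrable_bounded_on_finite_measure[where E=E and B=1])
       (use Efin in \<open>auto simp: c_def norm_mult split: split_indicator\<close>)
  have *: "fourier (\<lambda>t. indicator E t * cis (2 * pi * (z \<bullet> t))) x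
      = cis (2 * pi * ((z - x) \<bullet> y)) * (LINT t|lebesgue. indicator E t * c t)"
    unfolding fourier_def integral_mult_right_zero[symmetric] c_def
    by (intro Bochner_Integration.integral_cong) (auto simp: cis_mult algebra_simps split: split_indicator)
  have "measure lebesgue E / 2 = (LINT t|lebesgue. indicator E t * (1/2))" by simp
  also have "\<dots> \<le> (LINT t|lebesgue. Re (indicator E t * c t))"
  proof (rule integral_mono)
    show "integrable lebesgue (\<lambda>t. indicator E t * (1/2::real))" using Efin by (simp add: integrable_real_indicator)
    show "integrable lebesgue (\<lambda>t. Re (indicator E t * c t))" using int by (rule integrable_Re)
    fix t
    show "indicator E t * (1/2) \<le> Re (indicator E t * c t)"
    proof (cases "t \<in> E")
      case True
      then have "norm (t - y) \<le> r" using E(2) by (auto simp: dist_norm norm_minus_commute)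
      then have "norm (z - x) * norm (t - y) \<le> 1/6"
        using x mult_left_mono[of "norm (t - y)" r "norm (x - z)"] by (simp add: norm_minus_commute)
      then have "\<bar>(z - x) \<bullet> (t - y)\<bar> \<le> 1/6" using Cauchy_Schwarz_ineq2[of "z - x" "t - y"] by linarith
      then have "\<bar>2 * pi * ((z - x) \<bullet> (t - y))\<bar> \<le> pi / 3"
        using pi_gt_zero mult_left_mono[of "\<bar>(z - x) \<bullet> (t - y)\<bar>" "1/6" "2 * pi"] by (simp add: abs_mult)
      then have "cos (pi/3) \<le> cos \<bar>2 * pi * ((z - x) \<bullet> (t - y))\<bar>"
        by (intro cos_monotone_0_pi_le) auto
      then show ?thesis using True by (simp add: c_def cos_60)
    qed simp
  qed
  also have "\<dots> = Re (LINT t|lebesgue. indicator E t * c t)" by (rule integral_Re[OF int])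
  also have "\<dots> \<le> cmod (LINT t|lebesgue. indicator E t * c t)" by (rule complex_Re_le_cmod)
  finally show ?thesis unfolding * by (simp add: norm_mult)
next
  case False
  then have "E = {}" using E(2) by (simp add: ball_empty)
  then show ?thesis by simp
qed

text \<open>The average of \<open>\<bar>K \<inter> ball y d\<bar>\<close> over \<open>y\<close> in a neighbourhood \<open>U\<close> of \<open>K\<close> with \<open>\<bar>U\<bar> \<le> 2\<bar>K\<bar>\<close> is,
  by Fubini, at least \<open>\<bar>ball 0 d\<bar>/2\<close>.\<close>

lemma half_density_small_balls_compact:
  fixes K :: "'a::euclidean_space set"
  assumes K: "compact K" "emeasure lborel K > 0"
  obtains e where "e > 0"
    "\<And>d. 0 < d \<Longrightarrow> d < e \<Longrightarrow> \<exists>y. emeasure lborel (ball y d) \<le> 2 * emeasure lborel (K \<inter> ball y d)"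
proof -
  have [measurable]: "K \<in> sets borel" using K(1) by (simp add: borel_compact)
  have Kfin: "emeasure lborel K < \<infinity>" using K(1) emeasure_compact_finite by blast
  have Kl: "K \<in> sets lebesgue" by simp
  have pos: "measure lebesgue K > 0"
    using K(2) Kfin by (simp add: measure_def enn2real_positive_iff)
  obtain U where U: "open U" "K \<subseteq> U" "(U - K) \<in> lmeasurable" "emeasure lebesgue (U - K) < ennreal (measure lebesgue K)"
    using sets_lebesgue_outer_open[OF Kl pos] by metis
  have [measurable]: "U \<in> sets borel" using U by simp
  have eK: "ennreal (measure lebesgue K) = emeasure lborel K"
    using Kfin by (simp add: measure_def)
  have "emeasure lborel U = emeasure lborel K + emeasure lborel (U - K)"
    using U(2) by (subst plus_emeasure) (auto intro: arg_cong2[of _ _ _ _ emeasure])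
  also have "emeasure lborel (U - K) < emeasure lborel K" using U(4) eK by (simp add: )
  finally have U2: "emeasure lborel U < 2 * emeasure lborel K"
    using Kfin by (simp add: mult_2 ennreal_add_left_cancel_less)
  obtain e where e: "e > 0" "(\<Union>x\<in>K. ball x e) \<subseteq> U"
    using compact_subset_open_imp_ball_epsilon_subset[OF K(1) U(1,2)] by metis
  have "\<exists>y. emeasure lborel (ball y d) \<le> 2 * emeasure lborel (K \<inter> ball y d)" if d: "0 < d" "d < e" for d
  proof (rule ccontr)
    assume "\<not> ?thesis"
    then have lt: "2 * emeasure lborel (K \<inter> ball y d) \<le> emeasure lborel (ball y d)" for y
      by (meson linear)
    define V where "V = unit_ball_vol DIM('a) * d ^ DIM('a)"
    have V: "emeasure lborel (ball y d) = ennreal V" for y :: 'a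
      unfolding V_def using d by (intro emeasure_ball) auto
    have Vpos: "V > 0" unfolding V_def using d by simp
    have zero: "emeasure lborel (K \<inter> ball y d) = 0" if "y \<notin> U" for y
    proof -
      have "K \<inter> ball y d = {}" using that e(2) d by (force simp: dist_commute)
      then show ?thesis by simp
    qed
    have m: "{p :: 'a \<times> 'a. dist (fst p) (snd p) < d} \<in> sets (lborel \<Otimes>\<^sub>M lborel)"
      unfolding lborel_prod by (simp, intro borel_open open_Collect_less continuous_intros)
    have half: "emeasure lborel (K \<inter> ball y d) \<le> ennreal (V / 2)" for y
      using lt[of y] Vpos unfolding V
      by (cases "emeasure lborel (K \<inter> ball y d)")
         (auto simp: ennreal_mult[symmetric] ennreal_numeral[symmetric] ennreal_mult_eq_top_iff top_unique simp del: ennreal_numeral)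
    \<comment> \<open>Both iterated integrals measure the set of pairs at distance less than
      \<open>d\<close> whose first point lies in \<open>K\<close>.\<close>
    have "emeasure lborel K * ennreal V = (\<integral>\<^sup>+x. \<integral>\<^sup>+y. indicator K x * indicator {p. dist (fst p) (snd p) < d} (x, y) \<partial>lborel \<partial>lborel)"
    proof -
      have "(\<integral>\<^sup>+y. indicator K x * indicator {p. dist (fst p) (snd p) < d} (x, y) \<partial>lborel) = indicator K x * ennreal V" for x :: 'a
      proof -
        have "(\<integral>\<^sup>+y. indicator K x * indicator {p. dist (fst p) (snd p) < d} (x, y) \<partial>lborel)
           = (\<integral>\<^sup>+y. indicator K x * indicator (ball x d) y \<partial>lborel)"
          by (intro nn_integral_cong) (auto split: split_indicator)
        also have "\<dots> = indicator K x * emeasure lborel (ball x d)"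
          by (subst nn_integral_cmult) (auto intro!: borel_measurable_indicator)
        finally show ?thesis by (simp only: V)
      qed
      then show ?thesis by (simp add: nn_integral_multc)
    qed
    also have "\<dots> = (\<integral>\<^sup>+y. \<integral>\<^sup>+x. indicator K x * indicator {p. dist (fst p) (snd p) < d} (x, y) \<partial>lborel \<partial>lborel)"
      using m by (subst lborel_pair.Fubini') auto
    also have "\<dots> = (\<integral>\<^sup>+y. emeasure lborel (K \<inter> ball y d) \<partial>lborel)"
    proof (intro nn_integral_cong)
      fix y :: 'a
      have "(\<integral>\<^sup>+x. indicator K x * indicator {p. dist (fst p) (snd p) < d} (x, y) \<partial>lborel)
        = (\<integral>\<^sup>+x. indicator (K \<inter> ball y d) x \<partial>lborel)"
        by (intro nn_integral_cong) (auto simp: dist_commute split: split_indicator)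
      then show "(\<integral>\<^sup>+x. indicator K x * indicator {p. dist (fst p) (snd p) < d} (x, y) \<partial>lborel)
        = emeasure lborel (K \<inter> ball y d)" by simp
    qed
    also have "\<dots> \<le> (\<integral>\<^sup>+y. ennreal (V / 2) * indicator U y \<partial>lborel)"
      using half zero by (intro nn_integral_mono) (auto split: split_indicator)
    also have "\<dots> = ennreal (V / 2) * emeasure lborel U" by (simp add: nn_integral_cmult)
    also have "\<dots> < emeasure lborel K * ennreal V"
      using U2 Vpos Kfin
      by (cases "emeasure lborel K"; cases "emeasure lborel U")
         (auto simp: ennreal_mult[symmetric] ennreal_less_iff ennreal_numeral[symmetric] simp del: ennreal_numeral)
    finally show False by simp
  qed
  then show ?thesis using that e(1) by blast
qed

lemma half_density_small_balls:
  fixes E :: "'a::euclidean_space set"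
  assumes E: "E \<in> sets lebesgue" "emeasure lebesgue E > 0"
  obtains e where "e > 0"
    "\<And>d. 0 < d \<Longrightarrow> d < e \<Longrightarrow> \<exists>y. emeasure lebesgue (ball y d) \<le> 2 * emeasure lebesgue (E \<inter> ball y d)"
proof -
  have "\<exists>R::nat. emeasure lebesgue (E \<inter> cball 0 (real R)) > 0"
  proof (rule ccontr)
    assume "\<not> ?thesis"
    then have "(\<Union>R::nat. E \<inter> cball 0 (real R)) \<in> null_sets lebesgue"
      using E(1) by (intro null_sets_UN) (auto simp: null_sets_def)
    moreover have "(\<Union>R::nat. E \<inter> cball 0 (real R)) = E"
      by (auto simp: real_arch_simple)
    ultimately show False using E(2) by auto
  qed
  then obtain R :: nat where R: "emeasure lebesgue (E \<inter> cball 0 (real R)) > 0" by blast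
  define S where "S = E \<inter> cball 0 (real R)"
  have S: "S \<in> lmeasurable" unfolding S_def using E(1)
    by (intro fmeasurable_Int_fmeasurable[OF lmeasurable_cball, THEN back_subst[of "\<lambda>X. X \<in> lmeasurable"]]) auto
  have Spos: "measure lebesgue S / 2 > 0"
    using R S by (auto simp: S_def measure_def enn2real_positive_iff fmeasurable_def simp del: emeasure_completion)
  obtain K where K: "closed K" "K \<subseteq> S" "S - K \<in> lmeasurable" "emeasure lebesgue (S - K) < ennreal (measure lebesgue S / 2)"
    using sets_lebesgue_inner_closed[OF fmeasurableD[OF S] Spos] by metis
  have cK: "compact K" unfolding compact_eq_bounded_closed
    using K(1,2) bounded_subset[OF bounded_cball] by (auto simp: S_def)
  have "emeasure lebesgue K > 0"
  proof (rule ccontr)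
    assume "\<not> ?thesis"
    then have "K \<in> null_sets lebesgue" using K(1) by (auto simp: null_sets_def)
    then have "emeasure lebesgue (S - K) = emeasure lebesgue S" using S by (intro emeasure_Diff_null_set) auto
    also have "\<dots> = ennreal (measure lebesgue S)" using S by (simp add: emeasure_eq_measure2)
    finally show False using K(4) Spos by (simp add: ennreal_less_iff)
  qed
  then have Kp: "emeasure lborel K > 0" using K(1) by simp
  obtain e where e: "e > 0"
    "\<And>d. 0 < d \<Longrightarrow> d < e \<Longrightarrow> \<exists>y. emeasure lborel (ball y d) \<le> 2 * emeasure lborel (K \<inter> ball y d)"
    using half_density_small_balls_compact[OF cK Kp] by metis
  have "\<exists>y. emeasure lebesgue (ball y d) \<le> 2 * emeasure lebesgue (E \<inter> ball y d)" if d: "0 < d" "d < e" for d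
  proof -
    obtain y where y: "emeasure lborel (ball y d) \<le> 2 * emeasure lborel (K \<inter> ball y d)" using e(2)[OF d] by blast
    have "emeasure lborel (K \<inter> ball y d) = emeasure lebesgue (K \<inter> ball y d)" using K(1) by simp
    also have "\<dots> \<le> emeasure lebesgue (E \<inter> ball y d)"
      using K(2) E(1) by (intro emeasure_mono) (auto simp: S_def)
    finally have "2 * emeasure lborel (K \<inter> ball y d) \<le> 2 * emeasure lebesgue (E \<inter> ball y d)" by (intro mult_left_mono) auto
    with y have "emeasure lebesgue (ball y d) \<le> 2 * emeasure lebesgue (E \<inter> ball y d)" by simp
    then show ?thesis ..
  qed
  then show ?thesis using that e(1) by blast
qed

section \<open>Rearrangement invariant norms\<close>

text \<open>The growth hypothesis makes \<open>\<phi> t / sqrt t\<close> increasing up to a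
  constant. The map taking \<open>t\<close> to \<open>\<kappa> / t\<close> reverses the order, so
  the quotient is also decreasing up to a constant, hence bounded above and away from zero.\<close>

lemma sqrt_growth:
  fixes \<phi> :: "real \<Rightarrow> real"
  assumes mono: "\<And>s t. 0 \<le> s \<Longrightarrow> s \<le> t \<Longrightarrow> \<phi> s \<le> \<phi> t"
    and pos: "\<And>t. t > 0 \<Longrightarrow> \<phi> t > 0"
    and c: "c > 0" "\<And>N t. N \<ge> (1::nat) \<Longrightarrow> t > 0 \<Longrightarrow> c * sqrt (real N) * \<phi> t \<le> \<phi> (real N * t)"
    and \<kappa>: "\<kappa> > 0" "C > 0" "\<And>t. t > 0 \<Longrightarrow> t * \<phi> (\<kappa> / t) \<le> C * \<phi> t"
  obtains k1 k2 where "k1 > 0" "k2 > 0" "\<And>t. t > 0 \<Longrightarrow> k1 * sqrt t \<le> \<phi> t" "\<And>t. t > 0 \<Longrightarrow> \<phi> t \<le> k2 * sqrt t"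
proof -
  define q where "q t = \<phi> t / sqrt t" for t
  define K where "K = sqrt 2 / c"
  define C' where "C' = C / sqrt \<kappa>"
  have Kpos: "K > 0" "C' > 0" using c \<kappa> by (auto simp: K_def C'_def)
  have grow: "q t \<le> K * q s" if "0 < t" "t \<le> s" for s t
  proof -
    \<comment> \<open>As \<open>s / t\<close> is at least 1, rounding down loses at most a factor 2:
      this is the \<open>sqrt 2\<close> in \<open>K\<close>.\<close>
    define N where "N = nat \<lfloor>s / t\<rfloor>"
    have st: "s / t \<ge> 1" using that by simp
    have N: "real N \<le> s / t" "s / t < real N + 1" "N \<ge> 1"
      using st by (auto simp: N_def le_nat_floor)
    have "s / t \<le> 2 * real N" using N by linarith
    then have "sqrt s \<le> sqrt (2 * real N * t)" using that by (simp add: field_simps)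
    also have "\<dots> = sqrt 2 * sqrt (real N) * sqrt t" by (simp add: real_sqrt_mult)
    finally have s: "sqrt s \<le> sqrt 2 * sqrt (real N) * sqrt t" .
    have "c * sqrt (real N) * \<phi> t \<le> \<phi> (real N * t)" using N that by (intro c) auto
    also have "\<dots> \<le> \<phi> s" using N that by (intro mono) (auto simp: field_simps)
    finally have 1: "c * sqrt (real N) * \<phi> t \<le> \<phi> s" .
    have "c * (sqrt s * \<phi> t) \<le> c * (sqrt 2 * sqrt (real N) * sqrt t * \<phi> t)"
      using c s pos[of t] that by (intro mult_left_mono mult_right_mono) auto
    also have "\<dots> = sqrt 2 * sqrt t * (c * sqrt (real N) * \<phi> t)" by simp
    also have "\<dots> \<le> sqrt 2 * sqrt t * \<phi> s" using 1 that by (intro mult_left_mono) auto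
    finally show ?thesis using that c by (simp add: q_def K_def field_simps)
  qed
  have refl: "q (\<kappa> / t) \<le> C' * q t" if "t > 0" for t
  proof -
    have "sqrt t * \<phi> (\<kappa> / t) = t * \<phi> (\<kappa> / t) / sqrt t"
      using that by (simp add: real_div_sqrt flip: times_divide_eq_left)
    also have "\<dots> \<le> C * \<phi> t / sqrt t" using \<kappa>(3)[OF that] that by (intro divide_right_mono) auto
    finally have "sqrt t * \<phi> (\<kappa> / t) \<le> C * \<phi> t / sqrt t" .
    then have "sqrt t * \<phi> (\<kappa> / t) / sqrt \<kappa> \<le> C * \<phi> t / sqrt t / sqrt \<kappa>"
      using \<kappa> by (intro divide_right_mono) auto
    then show ?thesis by (simp add: q_def C'_def real_sqrt_divide field_simps)
  qed
  \<comment> \<open>The fixed point of the reflection is the reference point: \<open>t\<close> and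
    \<open>\<kappa> / t\<close> lie on opposite sides of it.\<close>
  define u where "u = sqrt \<kappa>"
  have u: "u > 0" "u * u = \<kappa>" using \<kappa> by (auto simp: u_def)
  have qu: "q u > 0" using u pos by (simp add: q_def)
  define M where "M = K * (1 + C')"
  have M: "M > 0" using Kpos by (simp add: M_def add_pos_pos)
  have qpos: "q t > 0" if "t > 0" for t using that pos by (simp add: q_def)
  have *: "q t \<le> M * q u \<and> q u \<le> M * q t" if t: "t > 0" for t
  proof (cases "t \<le> u")
    case True
    have 1: "q t \<le> K * q u" using grow True t by blast
    have "u \<le> \<kappa> / t" using True t u by (simp add: pos_le_divide_eq flip: u(2))
    then have "q u \<le> K * q (\<kappa> / t)" using grow u by blast
    also have "\<dots> \<le> K * (C' * q t)" using refl[OF t] Kpos by (intro mult_left_mono) auto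
    finally have 2: "q u \<le> K * C' * q t" by simp
    have "0 < K * C' * q u" "0 < K * q t" using Kpos qu qpos[OF t] by auto
    with 1 2 show ?thesis unfolding M_def by (simp add: algebra_simps)
  next
    case False
    then have 1: "q u \<le> K * q t" using grow u by auto
    have k: "\<kappa> / t \<le> u" "\<kappa> / t > 0" using False t u \<kappa> by (auto simp: pos_divide_le_eq simp flip: u(2))
    have "q t = q (\<kappa> / (\<kappa> / t))" using t \<kappa> by simp
    also have "\<dots> \<le> C' * q (\<kappa> / t)" using refl[OF k(2)] .
    also have "\<dots> \<le> C' * (K * q u)" using grow[OF k(2,1)] Kpos by (intro mult_left_mono) auto
    finally have 2: "q t \<le> K * C' * q u" by (simp add: mult_ac)
    have "0 < K * C' * q t" "0 < K * q u" using Kpos qu qpos[OF t] by auto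
    with 1 2 show ?thesis unfolding M_def by (simp add: algebra_simps)
  qed
  show ?thesis
  proof (rule that)
    show "q u / M > 0" "M * q u > 0" using qu M by auto
    fix t :: real assume t: "t > 0"
    show "q u / M * sqrt t \<le> \<phi> t" "\<phi> t \<le> M * q u * sqrt t"
    proof -
      have \<phi>: "\<phi> t = q t * sqrt t" using t by (simp add: q_def)
      have "q u / M \<le> q t" using *[OF t] M by (simp add: pos_divide_le_eq mult.commute)
      then show "q u / M * sqrt t \<le> \<phi> t" unfolding \<phi> using t by (intro mult_right_mono) auto
      show "\<phi> t \<le> M * q u * sqrt t" unfolding \<phi> using *[OF t] t by (intro mult_right_mono) auto
    qed
  qed
qed

section \<open>Step functions on disjoint pieces and dyadic layers\<close>

definition step_fun :: "'i set \<Rightarrow> ('i \<Rightarrow> real) \<Rightarrow> ('i \<Rightarrow> 'a set) \<Rightarrow> 'a \<Rightarrow> ennreal" where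
  "step_fun J a E x = (\<Sum>j\<in>J. ennreal (a j) * indicator (E j) x)"

lemma step_fun_on:
  assumes "finite J" "disjoint_family_on E J" "j \<in> J" "x \<in> E j"
  shows "step_fun J a E x = ennreal (a j)"
proof -
  have "step_fun J a E x = (\<Sum>i\<in>J. if i = j then ennreal (a i) else 0)"
    unfolding step_fun_def using assms
    by (intro sum.cong) (auto simp: disjoint_family_on_def split: split_indicator)
  then show ?thesis using assms by simp
qed

lemma step_fun_off: "x \<notin> (\<Union>j\<in>J. E j) \<Longrightarrow> step_fun J a E x = 0"
  by (auto simp: step_fun_def intro!: sum.neutral split: split_indicator)

lemma step_fun_measurable [measurable]:
  "(\<And>j. j \<in> J \<Longrightarrow> E j \<in> sets M) \<Longrightarrow> step_fun J a E \<in> borel_measurable M"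
  unfolding step_fun_def by (intro borel_measurable_sum borel_measurable_times_ennreal borel_measurable_indicator) auto

lemma separated_centres:
  assumes "finite J"
  obtains y :: "'i \<Rightarrow> 'a::euclidean_space" where "disjoint_family_on (\<lambda>j. ball (y j) r) J"
proof -
  obtain f :: "'i \<Rightarrow> nat" where f: "inj_on f J"
    using assms finite_imp_inj_to_nat_seg by blast
  obtain b :: 'a where b: "b \<in> Basis" using nonempty_Basis by blast
  define y where "y j = (2 * r * real (f j)) *\<^sub>R b" for j
  have "ball (y i) r \<inter> ball (y j) r = {}" if "i \<in> J" "j \<in> J" "i \<noteq> j" for i j
  proof (cases "r > 0")
    case True
    have "f i \<noteq> f j" using that f by (auto simp: inj_on_def)
    then have "1 \<le> \<bar>real (f i) - real (f j)\<bar>" by linarith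
    then have "2 * r \<le> 2 * r * \<bar>real (f i) - real (f j)\<bar>" using True by simp
    also have "\<dots> = dist (y i) (y j)"
      using b True by (simp add: y_def dist_norm abs_mult flip: scaleR_left_diff_distrib right_diff_distrib)
    finally show ?thesis by (intro disjoint_ballI) simp
  qed (simp add: ball_empty)
  then have "disjoint_family_on (\<lambda>j. ball (y j) r) J" by (auto simp: disjoint_family_on_def)
  then show ?thesis by (rule that)
qed

text \<open>If the layers up to index k are the active ones, the right side is the geometric sum
  \<open>2 ^ (k + 1) * A\<close>, the upper end of the dyadic interval containing
  \<open>u\<close>.\<close>

lemma layer_bound:
  fixes u A :: real
  assumes "A > 0" "u \<ge> 0" "u \<le> 2 ^ N * A"
  shows "u \<le> A + (\<Sum>k<N. 2 ^ k * A * indicator {v. 2 ^ k * A < v} u)"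
  using assms(3)
proof (induction N)
  case (Suc N)
  show ?case
  proof (cases "u \<le> 2 ^ N * A")
    case True
    have "0 \<le> 2 ^ N * A * indicator {v. 2 ^ N * A < v} u" using assms by simp
    then show ?thesis using Suc.IH[OF True] by simp
  next
    case False
    have "2 ^ k * A < u" if "k < Suc N" for k
    proof -
      have "(2::real) ^ k \<le> 2 ^ N" using that by (intro power_increasing) auto
      then have "2 ^ k * A \<le> 2 ^ N * A" using assms by simp
      then show ?thesis using False by simp
    qed
    then have "(\<Sum>k<Suc N. 2 ^ k * A * indicator {v. 2 ^ k * A < v} u) = (\<Sum>k<Suc N. 2 ^ k * A)"
      by (intro sum.cong) auto
    also have "\<dots> = (\<Sum>k<Suc N. 2 ^ k) * A" by (rule sum_distrib_right[symmetric])
    also have "(\<Sum>k<Suc N. (2::real) ^ k) = 2 ^ Suc N - 1" by (subst sum_gp_strict) simp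
    finally have *: "(\<Sum>k<Suc N. 2 ^ k * A * indicator {v. 2 ^ k * A < v} u) = 2 ^ Suc N * A - A"
      by (simp only: left_diff_distrib mult_1)
    show ?thesis unfolding * using Suc.prems by simp
  qed
qed auto

section \<open>The norm axioms and the fundamental function\<close>

locale ri_function_norm =
  fixes \<rho> :: "('a::euclidean_space \<Rightarrow> ennreal) \<Rightarrow> ennreal"
  assumes ri_norm: "ri_norm \<rho>"
begin

lemma eq_0_iff: "f \<in> borel_measurable lebesgue \<Longrightarrow> \<rho> f = 0 \<longleftrightarrow> (AE x in lebesgue. f x = 0)"
  using ri_norm unfolding ri_norm_def by blast

lemma cmult: "f \<in> borel_measurable lebesgue \<Longrightarrow> a \<ge> 0 \<Longrightarrow> \<rho> (\<lambda>x. ennreal a * f x) = ennreal a * \<rho> f"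
  using ri_norm unfolding ri_norm_def by blast

lemma add_le: "f \<in> borel_measurable lebesgue \<Longrightarrow> g \<in> borel_measurable lebesgue \<Longrightarrow> \<rho> (\<lambda>x. f x + g x) \<le> \<rho> f + \<rho> g"
  using ri_norm unfolding ri_norm_def by blast

lemma mono_AE:
  "f \<in> borel_measurable lebesgue \<Longrightarrow> g \<in> borel_measurable lebesgue \<Longrightarrow> AE x in lebesgue. g x \<le> f x \<Longrightarrow> \<rho> g \<le> \<rho> f"
  using ri_norm unfolding ri_norm_def by blast

lemma mono:
  "f \<in> borel_measurable lebesgue \<Longrightarrow> g \<in> borel_measurable lebesgue \<Longrightarrow> (\<And>x. g x \<le> f x) \<Longrightarrow> \<rho> g \<le> \<rho> f"
  by (rule mono_AE) auto

lemma SUP_AE: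
  assumes "\<And>k. F k \<in> borel_measurable lebesgue" "f \<in> borel_measurable lebesgue"
    "AE x in lebesgue. incseq (\<lambda>k. F k x) \<and> (SUP k. F k x) = f x"
  shows "(SUP k. \<rho> (F k)) = \<rho> f"
  using ri_norm assms unfolding ri_norm_def by blast

lemma indicator_finite: "E \<in> sets lebesgue \<Longrightarrow> emeasure lebesgue E < \<infinity> \<Longrightarrow> \<rho> (indicator E) < \<infinity>"
  using ri_norm unfolding ri_norm_def by blast

lemma equimeasurable:
  assumes "f \<in> borel_measurable lebesgue" "g \<in> borel_measurable lebesgue"
    "\<And>t. t > 0 \<Longrightarrow> emeasure lebesgue {x. f x > ennreal t} = emeasure lebesgue {x. g x > ennreal t}"
  shows "\<rho> f = \<rho> g"
proof -
  have *: "\<forall>f \<in> borel_measurable lebesgue. \<forall>g \<in> borel_measurable lebesgue.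
        (\<forall>t::real. t > 0 \<longrightarrow>
           emeasure lebesgue {x. f x > ennreal t} = emeasure lebesgue {x. g x > ennreal t})
        \<longrightarrow> \<rho> f = \<rho> g"
    using ri_norm unfolding ri_norm_def by (elim conjE)
  show ?thesis by (rule *[rule_format, OF assms])
qed

lemma zero: "\<rho> (\<lambda>x. 0) = 0"
  by (subst eq_0_iff) auto

lemma sum_le:
  assumes "\<And>j. j \<in> J \<Longrightarrow> f j \<in> borel_measurable lebesgue"
  shows "\<rho> (\<lambda>x. \<Sum>j\<in>J. f j x) \<le> (\<Sum>j\<in>J. \<rho> (f j))"
  using assms
proof (induction J rule: infinite_finite_induct)
  case (insert k J)
  have "\<rho> (\<lambda>x. f k x + (\<Sum>j\<in>J. f j x)) \<le> \<rho> (f k) + \<rho> (\<lambda>x. \<Sum>j\<in>J. f j x)"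
    using insert.prems by (intro add_le) auto
  also have "\<dots> \<le> \<rho> (f k) + (\<Sum>j\<in>J. \<rho> (f j))" using insert by (intro add_left_mono) auto
  finally show ?case using insert.hyps by simp
qed (simp_all add: zero)

text \<open>The fundamental function of the space, read off from a ball of volume \<open>t\<close>;
  \<open>rho_indicator\<close> shows that any other set of that measure gives the same value. Since
  indicators of sets of finite measure have finite norm, \<open>enn2real\<close> loses
  nothing.\<close>

definition fund :: "real \<Rightarrow> real" where
  "fund t = enn2real (\<rho> (indicator (ball 0 (root DIM('a) (t / unit_ball_vol DIM('a))))))"

lemma ball_of_volume:
  assumes "t \<ge> 0"
  shows "emeasure lebesgue (ball (y::'a) (root DIM('a) (t / unit_ball_vol DIM('a)))) = ennreal t"
proof -
  have "unit_ball_vol (real DIM('a)) \<noteq> 0" using unit_ball_vol_pos[of "real DIM('a)"] by linarith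
  then show ?thesis using assms
    by (subst emeasure_lebesgue_ball) (simp_all add: real_root_pow_pos2)
qed

lemma step_fun_superlevel:
  assumes "finite J" "disjoint_family_on E J" "t > 0"
  shows "{x. step_fun J a E x > ennreal t} = (\<Union>j\<in>{j\<in>J. a j > t}. E j)"
proof (intro set_eqI iffI)
  fix x assume x: "x \<in> {x. step_fun J a E x > ennreal t}"
  then have "x \<in> (\<Union>j\<in>J. E j)" using step_fun_off[of x E J a] by fastforce
  then obtain j where "j \<in> J" "x \<in> E j" by blast
  moreover from this have "a j > t"
    using x step_fun_on[OF assms(1,2)] assms(3) by (auto simp: ennreal_less_iff)
  ultimately show "x \<in> (\<Union>j\<in>{j\<in>J. a j > t}. E j)" by auto
next
  fix x assume "x \<in> (\<Union>j\<in>{j\<in>J. a j > t}. E j)"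
  then show "x \<in> {x. step_fun J a E x > ennreal t}"
    using step_fun_on[OF assms(1,2)] assms(3) by (auto simp: ennreal_less_iff)
qed

text \<open>Superlevel sets are unions of pieces, so only the measures of the pieces count. This is
  where rearrangement invariance enters: arbitrary pieces are exchanged for balls, whose transforms
  can be estimated.\<close>

lemma step_fun_equimeasurable:
  assumes J: "finite J" and E: "disjoint_family_on E J" "\<And>j. j \<in> J \<Longrightarrow> E j \<in> sets lebesgue"
    and E': "disjoint_family_on E' J" "\<And>j. j \<in> J \<Longrightarrow> E' j \<in> sets lebesgue"
    and eq: "\<And>j. j \<in> J \<Longrightarrow> emeasure lebesgue (E j) = emeasure lebesgue (E' j)"
  shows "\<rho> (step_fun J a E) = \<rho> (step_fun J a E')"
proof (rule equimeasurable)
  show "step_fun J a E \<in> borel_measurable lebesgue" "step_fun J a E' \<in> borel_measurable lebesgue"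
    using E E' by auto
  fix t :: real assume "t > 0"
  note * = step_fun_superlevel[OF J _ this, of _ a]
  have "disjoint_family_on E {j\<in>J. a j > t}" "disjoint_family_on E' {j\<in>J. a j > t}"
    using E(1) E'(1) by (auto simp: disjoint_family_on_def)
  then show "emeasure lebesgue {x. step_fun J a E x > ennreal t} = emeasure lebesgue {x. step_fun J a E' x > ennreal t}"
    unfolding *[OF E(1)] *[OF E'(1)] using J E(2) E'(2) eq
    by (subst (1 2) sum_emeasure[symmetric]) (auto simp del: emeasure_completion intro!: sum.cong)
qed

lemma step_fun_singleton: "step_fun {j} (\<lambda>_. 1) E = indicator (E j)"
  by (rule ext) (simp add: step_fun_def)

lemma rho_indicator:
  assumes "E \<in> sets lebesgue" "emeasure lebesgue E = ennreal t" "t \<ge> 0"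
  shows "\<rho> (indicator E) = ennreal (fund t)"
proof -
  define B where "B = ball (0::'a) (root DIM('a) (t / unit_ball_vol DIM('a)))"
  have B: "B \<in> sets lebesgue" "emeasure lebesgue B = ennreal t"
    using ball_of_volume[OF assms(3), of 0] by (auto simp: B_def)
  have "\<rho> (step_fun {()} (\<lambda>_. 1) (\<lambda>_. E)) = \<rho> (step_fun {()} (\<lambda>_. 1) (\<lambda>_. B))"
    using assms B by (intro step_fun_equimeasurable) (auto simp: disjoint_family_on_def simp del: emeasure_completion)
  then have "\<rho> (indicator E) = \<rho> (indicator B)" by (simp add: step_fun_singleton)
  also have "\<dots> = ennreal (fund t)"
    using indicator_finite[OF B(1)] B(2) by (simp add: fund_def B_def[symmetric])
  finally show ?thesis .
qed

lemma fund_nonneg: "fund t \<ge> 0" by (simp add: fund_def)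

lemma fund_mono:
  assumes "0 \<le> s" "s \<le> t"
  shows "fund s \<le> fund t"
proof -
  define B where "B t = ball (0::'a) (root DIM('a) (t / unit_ball_vol DIM('a)))" for t
  have "B s \<subseteq> B t" unfolding B_def using assms
    by (intro subset_ball) (simp add: divide_right_mono)
  then have "\<rho> (indicator (B s)) \<le> \<rho> (indicator (B t))"
    by (intro mono borel_measurable_indicator) (auto simp: B_def split: split_indicator)
  moreover have "\<rho> (indicator (B u)) = ennreal (fund u)" if "u \<ge> 0" for u
    unfolding B_def using that ball_of_volume[OF that, of 0] by (intro rho_indicator) auto
  ultimately show ?thesis using assms fund_nonneg by simp
qed

lemma fund_pos:
  assumes "t > 0"
  shows "fund t > 0"
proof (rule ccontr)
  define B where "B = ball (0::'a) (root DIM('a) (t / unit_ball_vol DIM('a)))"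
  have B: "B \<in> sets lebesgue" "emeasure lebesgue B = ennreal t"
    using ball_of_volume[of t 0] assms by (auto simp: B_def)
  assume "\<not> fund t > 0"
  then have "\<rho> (indicator B) = 0"
    using rho_indicator[OF B] assms fund_nonneg[of t] by simp
  then have "AE x in lebesgue. indicator B x = (0::ennreal)" using B by (subst (asm) eq_0_iff) auto
  then have "emeasure lebesgue B = 0" using B(1)
    by (subst emeasure_eq_AE[where B="{}"]) (auto simp del: emeasure_completion elim!: eventually_mono split: split_indicator_asm)
  then show False using B(2) assms by simp
qed

lemma fund_0: "fund 0 = 0"
proof -
  have "ennreal (fund 0) = \<rho> (\<lambda>x. 0)"
    using rho_indicator[of "{}" 0] by (simp add: indicator_def[abs_def])
  then show ?thesis using zero fund_nonneg[of 0] by simp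
qed

text \<open>The set where \<open>F > 2^k A\<close> has measure at most \<open>\<integral>F^4 / (2^k A)^4\<close>; the arithmetic-geometric
  mean makes the resulting bound linear in \<open>\<integral>F^4\<close>, hence stable under averaging.\<close>

lemma fourth_moment_bound:
  fixes F :: "'a \<Rightarrow> real"
  assumes k: "\<And>t. t > 0 \<Longrightarrow> fund t \<le> k * sqrt t" "k > 0"
    and Q: "Q \<in> sets lebesgue" "emeasure lebesgue Q = ennreal s" "s > 0"
    and F: "F \<in> borel_measurable lebesgue" "\<And>x. F x \<ge> 0" "\<And>x. x \<notin> Q \<Longrightarrow> F x = 0" "\<And>x. F x \<le> M"
    and A: "A > 0"
  shows "\<rho> (\<lambda>x. ennreal (F x)) \<le> ennreal (k * (2 * A * sqrt s + (LINT x|lebesgue. F x ^ 4) / (A ^ 3 * sqrt s)))"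
proof -
  define I where "I = (LINT x|lebesgue. F x ^ 4)"
  have [measurable]: "F \<in> borel_measurable lebesgue" "Q \<in> sets lebesgue" by fact+
  have I0: "I \<ge> 0" by (simp add: I_def)
  have Mp: "M \<ge> 0" using F(2,4) order_trans by blast
  have int: "integrable lebesgue (\<lambda>x. F x ^ 4)"
  proof (rule Bochner_Integration.integrable_bound[where f="\<lambda>x. M ^ 4 * indicator Q x :: real"])
    show "integrable lebesgue (\<lambda>x. M ^ 4 * indicator Q x :: real)"
      using Q by (intro integrable_mult_right integrable_real_indicator) auto
    show "AE x in lebesgue. norm (F x ^ 4) \<le> norm (M ^ 4 * indicator Q x :: real)"
      using F Mp by (intro AE_I2) (auto intro!: power_mono split: split_indicator)
  qed measurable
  \<comment> \<open>The bound \<open>M\<close> makes the number of layers finite; geometric decay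
    keeps \<open>N\<close> out of the final estimate.\<close>
  obtain N where N: "M / A < 2 ^ N" using real_arch_pow[of 2 "M / A"] by auto
  define G where "G j = {x. F x > 2 ^ j * A}" for j :: nat
  have [measurable]: "G j \<in> sets lebesgue" for j
  proof -
    have "{x \<in> space lebesgue. F x > 2 ^ j * A} \<in> sets lebesgue" by measurable
    then show ?thesis by (simp add: G_def)
  qed
  have GQ: "G j \<subseteq> Q" for j
  proof
    fix x assume "x \<in> G j"
    moreover have "0 < 2 ^ j * A" using A by simp
    ultimately have "F x \<noteq> 0" by (auto simp: G_def)
    then show "x \<in> Q" using F(3) by blast
  qed
  have Gfin: "emeasure lebesgue (G j) < \<infinity>" for j
    using emeasure_mono[OF GQ, of lebesgue j] Q by (auto simp: top_unique less_top[symmetric])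
  have "fund (measure lebesgue (G j)) \<le> k * (sqrt I / (4 ^ j * A\<^sup>2))" for j
  \<comment> \<open>Chebyshev's inequality at the fourth power. The estimate for \<open>fund\<close>
    is available at positive arguments only, so null layers are settled by
    \<open>fund_0\<close>.\<close>
  proof (cases "measure lebesgue (G j) > 0")
    case True
    have "(2 ^ j * A) ^ 4 * measure lebesgue (G j) = (LINT x|lebesgue. (2 ^ j * A) ^ 4 * indicator (G j) x)"
      by simp
    also have "\<dots> \<le> I" unfolding I_def
    proof (rule integral_mono[OF _ int])
      show "integrable lebesgue (\<lambda>x. (2 ^ j * A) ^ 4 * indicator (G j) x :: real)"
        using Gfin by (intro integrable_mult_right integrable_real_indicator) auto
      show "(2 ^ j * A) ^ 4 * indicator (G j) x \<le> F x ^ 4" for x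
        using F(2) A by (auto simp: G_def intro!: power_mono split: split_indicator)
    qed
    also have "(2 ^ j * A) ^ 4 = (4 ^ j * A\<^sup>2)\<^sup>2"
    proof -
      have "(4::real) ^ j = 2 ^ j * 2 ^ j" by (simp flip: power_mult_distrib)
      then show ?thesis by (simp add: power4_eq_xxxx power2_eq_square mult_ac)
    qed
    finally have "sqrt ((4 ^ j * A\<^sup>2)\<^sup>2 * measure lebesgue (G j)) \<le> sqrt I" by (rule real_sqrt_le_mono)
    then have "4 ^ j * A\<^sup>2 * sqrt (measure lebesgue (G j)) \<le> sqrt I"
      by (simp add: real_sqrt_mult)
    then have "sqrt (measure lebesgue (G j)) \<le> sqrt I / (4 ^ j * A\<^sup>2)"
      using A by (simp add: field_simps)
    then have "k * sqrt (measure lebesgue (G j)) \<le> k * (sqrt I / (4 ^ j * A\<^sup>2))"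
      using k(2) by (intro mult_left_mono) auto
    then show ?thesis using k(1)[OF True] by simp
  next
    case False
    then have "measure lebesgue (G j) = 0" by (simp add: not_less measure_le_0_iff)
    then show ?thesis using k(2) I0 by (simp add: fund_0)
  qed
  note fundG = this
  have F_le: "F x \<le> A * indicator Q x + (\<Sum>j<N. 2 ^ j * A * indicator (G j) x)" for x
  proof (cases "x \<in> Q")
    case True
    have "F x \<le> 2 ^ N * A" using N F(4)[of x] A by (simp add: field_simps)
    then show ?thesis using layer_bound[OF A F(2), of x N] True
      by (simp add: G_def indicator_def)
  next
    case False
    then show ?thesis using F(3) A by (auto intro!: sum_nonneg)
  qed
  have pt: "ennreal (F x) \<le> ennreal A * indicator Q x + (\<Sum>j<N. ennreal (2 ^ j * A) * indicator (G j) x)" for x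
  proof -
    have "ennreal (F x) \<le> ennreal (A * indicator Q x + (\<Sum>j<N. 2 ^ j * A * indicator (G j) x))"
      using F_le by (intro ennreal_leI)
    also have "\<dots> = ennreal A * indicator Q x + (\<Sum>j<N. ennreal (2 ^ j * A) * indicator (G j) x)"
      using A by (subst ennreal_plus) (auto simp: sum_nonneg ennreal_mult ennreal_indicator sum_ennreal[symmetric] simp del: sum_ennreal)
    finally show ?thesis .
  qed
  have "\<rho> (\<lambda>x. ennreal (F x)) \<le> \<rho> (\<lambda>x. ennreal A * indicator Q x + (\<Sum>j<N. ennreal (2 ^ j * A) * indicator (G j) x))"
    using pt by (intro mono) measurable
  also have "\<dots> \<le> \<rho> (\<lambda>x. ennreal A * indicator Q x) + \<rho> (\<lambda>x. \<Sum>j<N. ennreal (2 ^ j * A) * indicator (G j) x)"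
    by (intro add_le) measurable
  also have "\<dots> \<le> ennreal A * \<rho> (indicator Q) + (\<Sum>j<N. ennreal (2 ^ j * A) * \<rho> (indicator (G j)))"
    using A by (intro add_mono order.trans[OF sum_le]) (auto simp: cmult intro!: sum_mono)
  also have "\<dots> = ennreal A * ennreal (fund s) + (\<Sum>j<N. ennreal (2 ^ j * A) * ennreal (fund (measure lebesgue (G j))))"
    using Gfin Q by (intro arg_cong2[of _ _ _ _ "(+)"] sum.cong arg_cong2[of _ _ _ _ "(*)"] rho_indicator)
      (auto simp: emeasure_eq_ennreal_measure less_top[symmetric] simp del: emeasure_completion)
  also have "\<dots> = ennreal (A * fund s + (\<Sum>j<N. 2 ^ j * A * fund (measure lebesgue (G j))))"
    using A by (simp add: ennreal_plus sum_nonneg ennreal_mult fund_nonneg flip: sum_ennreal)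
  also have "\<dots> \<le> ennreal (k * (2 * A * sqrt s + I / (A ^ 3 * sqrt s)))"
  proof (rule ennreal_leI)
    \<comment> \<open>The layer height contributes \<open>2 ^ j\<close> and Chebyshev's inequality
      \<open>1 / 4 ^ j\<close>, which leaves a series of ratio 1/2.\<close>
    have "(\<Sum>j<N. 2 ^ j * A * fund (measure lebesgue (G j))) \<le> (\<Sum>j<N. k * sqrt I / A * (1/2) ^ j)"
    proof (rule sum_mono)
      fix j
      have "2 ^ j * A * fund (measure lebesgue (G j)) \<le> 2 ^ j * A * (k * (sqrt I / (4 ^ j * A\<^sup>2)))"
        using A fundG by (intro mult_left_mono) auto
      also have "\<dots> = k * sqrt I / A * (1/2) ^ j"
      proof -
        have "(4::real) ^ j = 2 ^ j * 2 ^ j" by (simp flip: power_mult_distrib)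
        then show ?thesis using A by (simp add: power2_eq_square field_simps)
      qed
      finally show "2 ^ j * A * fund (measure lebesgue (G j)) \<le> k * sqrt I / A * (1/2) ^ j" .
    qed
    also have "\<dots> = k * sqrt I / A * (\<Sum>j<N. (1/2) ^ j)" by (simp add: sum_distrib_left)
    also have "\<dots> \<le> k * sqrt I / A * 2"
      using k A I0 by (intro mult_left_mono) (auto simp: sum_gp_strict)
    finally have 1: "(\<Sum>j<N. 2 ^ j * A * fund (measure lebesgue (G j))) \<le> k * (2 * sqrt I / A)" by (simp add: mult_ac)
    have 2: "A * fund s \<le> k * (A * sqrt s)" using k(1)[OF Q(3)] A by (simp add: mult.left_commute)
    \<comment> \<open>The arithmetic-geometric mean inequality; passing to the fourth root
      \<open>p\<close> of \<open>s\<close> displays the difference as a square over a positive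
      number.\<close>
    have "2 * sqrt I / A \<le> A * sqrt s + I / (A ^ 3 * sqrt s)"
    proof -
      define p where "p = sqrt (sqrt s)"
      define q where "q = sqrt I"
      have p: "p > 0" "sqrt s = p\<^sup>2" using Q(3) by (auto simp: p_def)
      have q: "I = q\<^sup>2" using I0 by (simp add: q_def)
      have "0 \<le> (A\<^sup>2 * p\<^sup>2 - q)\<^sup>2 / (A ^ 3 * p\<^sup>2)" using A p by simp
      also have "\<dots> = A * p\<^sup>2 + q\<^sup>2 / (A ^ 3 * p\<^sup>2) - 2 * q / A"
        using A p by (simp add: field_simps power2_eq_square power3_eq_cube)
      finally have "2 * q / A \<le> A * p\<^sup>2 + q\<^sup>2 / (A ^ 3 * p\<^sup>2)" by simp
      also have "\<dots> = A * sqrt s + I / (A ^ 3 * sqrt s)" by (simp only: p(2) q)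
      finally show ?thesis unfolding q_def .
    qed
    then have "k * (2 * sqrt I / A) \<le> k * (A * sqrt s + I / (A ^ 3 * sqrt s))"
      using k(2) by (intro mult_left_mono) auto
    with 1 2 show "A * fund s + (\<Sum>j<N. 2 ^ j * A * fund (measure lebesgue (G j))) \<le> k * (2 * A * sqrt s + I / (A ^ 3 * sqrt s))"
      by (simp add: algebra_simps)
  qed
  finally show ?thesis unfolding I_def .
qed

end

section \<open>Step functions under a bounded Fourier transform\<close>

text \<open>At each point at most one term survives, so the signs disappear from the modulus and all
  sign choices have the same norm.\<close>

lemma cmod_signed_sum_disjoint:
  assumes "finite J" "disjoint_family_on E J" "\<And>j. j \<in> J \<Longrightarrow> a j \<ge> 0"
  shows "ennreal (cmod (signed_sum (\<lambda>j. of_real (a j) * indicator (E j) x) J T)) = step_fun J a E x"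
proof (cases "\<exists>j\<in>J. x \<in> E j")
  case True
  then obtain j where j: "j \<in> J" "x \<in> E j" by blast
  have "signed_sum (\<lambda>j. of_real (a j) * indicator (E j) x) J T
      = (\<Sum>i\<in>J. if i = j then (if j \<in> T then of_real (a j) else - of_real (a j)) else 0)"
    unfolding signed_sum_def using assms(2) j
    by (intro sum.cong) (auto simp: disjoint_family_on_def split: split_indicator)
  also have "\<dots> = (if j \<in> T then of_real (a j) else - of_real (a j))" using assms(1) j by simp
  finally show ?thesis using step_fun_on[OF assms(1,2) j] assms(3)[OF j(1)] by auto
next
  case False
  then have "signed_sum (\<lambda>j. of_real (a j) * indicator (E j) x) J T = 0"
    unfolding signed_sum_def by (intro sum.neutral) auto
  then show ?thesis using False step_fun_off[of x E J a] by simp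
qed

lemma (in ri_function_norm) step_fun_union:
  "finite J \<Longrightarrow> disjoint_family_on E J \<Longrightarrow> step_fun J (\<lambda>_. 1) E = indicator (\<Union>j\<in>J. E j)"
proof (rule ext)
  fix x assume "finite J" "disjoint_family_on E J"
  then show "step_fun J (\<lambda>_. 1) E x = indicator (\<Union>j\<in>J. E j) x"
    by (cases "x \<in> (\<Union>j\<in>J. E j)") (auto simp: step_fun_on step_fun_off)
qed

text \<open>The situation once the weight is removed. The bound can be stated for every integrable
  \<open>f\<close>, because \<open>D > 0\<close> makes the right side infinite whenever the norm of
  \<open>f\<close> is.\<close>

locale fourier_bounded = ri_function_norm \<rho>
  for \<rho> :: "('a::euclidean_space \<Rightarrow> ennreal) \<Rightarrow> ennreal" +
  fixes D :: real
  assumes D_pos: "D > 0"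
    and fourier_bound: "\<And>f. integrable lebesgue f \<Longrightarrow>
      \<rho> (\<lambda>x. ennreal (cmod (fourier f x))) \<le> ennreal D * \<rho> (\<lambda>x. ennreal (cmod (f x)))"
begin

text \<open>A pointwise minorant \<open>g\<close> of the averaged modulus of the transforms is what
  both step function estimates can supply. The triangle inequality for \<open>\<rho>\<close> moves
  the average outside the norm, where the Fourier bound applies to each choice of signs.\<close>

lemma averaged_fourier_bound:
  assumes J: "finite J" and f: "\<And>j. j \<in> J \<Longrightarrow> integrable lebesgue (f j)"
    and g: "g \<in> borel_measurable lebesgue"
    and le: "\<And>x. ennreal (2 ^ card J) * g x \<le> ennreal (\<Sum>T\<in>Pow J. cmod (signed_sum (\<lambda>j. fourier (f j) x) J T))"
  shows "ennreal (2 ^ card J) * \<rho> g \<le> ennreal D * (\<Sum>T\<in>Pow J. \<rho> (\<lambda>x. ennreal (cmod (signed_sum (\<lambda>j. f j x) J T))))"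
proof -
  define F where "F T x = signed_sum (\<lambda>j. f j x) J T" for T x
  have F: "F T = (\<lambda>x. \<Sum>j\<in>J. (if j \<in> T then 1 else -1) * f j x)" for T
    unfolding F_def signed_sum_def by (intro ext sum.cong) auto
  have Fint: "integrable lebesgue (F T)" for T
    unfolding F using f by (intro Bochner_Integration.integrable_sum integrable_mult_right) auto
  have FF: "fourier (F T) x = signed_sum (\<lambda>j. fourier (f j) x) J T" for T x
    unfolding F signed_sum_def using f
    by (subst fourier_sum) (auto simp: fourier_cmult intro!: sum.cong integrable_mult_right)
  note [measurable] = borel_measurable_fourier[OF Fint]
  have "ennreal (2 ^ card J) * \<rho> g = \<rho> (\<lambda>x. ennreal (2 ^ card J) * g x)" using g by (simp add: cmult)
  also have "\<dots> \<le> \<rho> (\<lambda>x. \<Sum>T\<in>Pow J. ennreal (cmod (fourier (F T) x)))"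
    using g le unfolding FF[symmetric] by (intro mono) (auto simp: sum_ennreal)
  also have "\<dots> \<le> (\<Sum>T\<in>Pow J. \<rho> (\<lambda>x. ennreal (cmod (fourier (F T) x))))"
    by (intro sum_le) auto
  also have "\<dots> \<le> (\<Sum>T\<in>Pow J. ennreal D * \<rho> (\<lambda>x. ennreal (cmod (F T x))))"
    by (intro sum_mono fourier_bound Fint)
  finally show ?thesis by (simp add: sum_distrib_left F_def)
qed

text \<open>The product of the volumes of two balls whose radii multiply to 1/6, so that
  \<open>t\<close> and \<open>dual_const / t\<close> are the volumes of balls at dual
  scales.\<close>

definition dual_const :: real where
  "dual_const = (unit_ball_vol DIM('a))\<^sup>2 / 6 ^ DIM('a)"

lemma dual_const_pos: "dual_const > 0"
  unfolding dual_const_def by (intro divide_pos_pos zero_less_power unit_ball_vol_pos) auto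

definition radius :: "real \<Rightarrow> real" where
  "radius t = root DIM('a) (t / unit_ball_vol DIM('a))"

lemma radius_dual: "t > 0 \<Longrightarrow> radius t * radius (dual_const / t) = 1 / 6"
proof -
  assume t: "t > 0"
  have v: "unit_ball_vol (real DIM('a)) \<noteq> 0" using unit_ball_vol_pos[of "real DIM('a)"] by linarith
  have "radius t * radius (dual_const / t)
      = root DIM('a) (t / unit_ball_vol DIM('a) * (dual_const / t / unit_ball_vol DIM('a)))"
    by (simp only: radius_def real_root_mult)
  also have "t / unit_ball_vol DIM('a) * (dual_const / t / unit_ball_vol DIM('a)) = (1 / 6) ^ DIM('a)"
    using t v by (simp add: dual_const_def power2_eq_square power_divide)
  finally show ?thesis by (simp add: real_root_power_cancel)
qed

lemma emeasure_ball_radius: "t \<ge> 0 \<Longrightarrow> emeasure lebesgue (ball (y::'a) (radius t)) = ennreal t"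
  unfolding radius_def by (rule ball_of_volume)

lemma measure_ball_radius: "t \<ge> 0 \<Longrightarrow> measure lebesgue (ball (y::'a) (radius t)) = t"
  using emeasure_ball_radius[of t y] by (simp add: measure_def del: emeasure_completion)

lemma step_fun_balls:
  assumes "finite J" "disjoint_family_on E J" "\<And>j. j \<in> J \<Longrightarrow> E j \<in> sets lebesgue"
    and "\<And>j. j \<in> J \<Longrightarrow> emeasure lebesgue (E j) = ennreal t" "t > 0"
  obtains y :: "'i \<Rightarrow> 'a" where "disjoint_family_on (\<lambda>j. ball (y j) (radius t)) J"
    "\<rho> (step_fun J a E) = \<rho> (step_fun J a (\<lambda>j. ball (y j) (radius t)))"
proof -
  obtain y :: "'i \<Rightarrow> 'a" where y: "disjoint_family_on (\<lambda>j. ball (y j) (radius t)) J"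
    using separated_centres[OF assms(1)] by blast
  have "\<rho> (step_fun J a E) = \<rho> (step_fun J a (\<lambda>j. ball (y j) (radius t)))"
    using assms y emeasure_ball_radius[of t]
    by (intro step_fun_equimeasurable) (auto simp del: emeasure_completion)
  with y show ?thesis by (rule that)
qed

text \<open>Translating a ball changes its transform only by a phase, so all pieces have transforms
  of modulus at least \<open>t / 2\<close> on one common ball \<open>Q\<close> about the origin.
  Khintchine's inequality on \<open>Q\<close> then prevents cancellation.\<close>

lemma step_fun_ge_fund:
  assumes J: "finite J" "\<And>j. j \<in> J \<Longrightarrow> a j \<ge> 0"
    and E: "disjoint_family_on E J" "\<And>j. j \<in> J \<Longrightarrow> E j \<in> sets lebesgue"
    "\<And>j. j \<in> J \<Longrightarrow> emeasure lebesgue (E j) = ennreal t" "t > 0"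
  shows "ennreal (t / 4 * sqrt (\<Sum>j\<in>J. (a j)\<^sup>2) * fund (dual_const / t)) \<le> ennreal D * \<rho> (step_fun J a E)"
proof -
  obtain y where y: "disjoint_family_on (\<lambda>j. ball (y j) (radius t)) J"
    "\<rho> (step_fun J a E) = \<rho> (step_fun J a (\<lambda>j. ball (y j) (radius t)))"
    by (rule step_fun_balls[OF J(1) E])
  define B where "B j = ball (y j) (radius t)" for j
  define s where "s = dual_const / t"
  have s: "s > 0" using E dual_const_pos by (simp add: s_def)
  define Q where "Q = ball (0::'a) (radius s)"
  have Q: "Q \<in> sets lebesgue" "emeasure lebesgue Q = ennreal s"
    using s emeasure_ball_radius[of s 0] by (auto simp: Q_def)
  have B: "B j \<in> sets lebesgue" "measure lebesgue (B j) = t" "emeasure lebesgue (B j) < \<infinity>" for j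
    using E(4) measure_ball_radius[of t "y j"] emeasure_ball_radius[of t "y j"] by (auto simp: B_def)
  define f where "f j = (\<lambda>x. complex_of_real (a j) * indicator (B j) x)" for j
  define A where "A = sqrt (\<Sum>j\<in>J. (a j)\<^sup>2)"
  have A: "A \<ge> 0" by (simp add: A_def sum_nonneg)
  have int: "integrable lebesgue (indicator (B j) :: _ \<Rightarrow> complex)" for j
    using B[of j] by (intro integrable_bounded_on_finite_measure[where E="B j" and B=1])
      (auto simp del: emeasure_completion split: split_indicator)
  have f_low: "t / 2 * a j \<le> cmod (fourier (f j) x)" if "j \<in> J" "x \<in> Q" for j x
  proof -
    have "norm (x - 0) * radius t \<le> 1 / 6"
    proof -
      have "norm x \<le> radius s" using that by (auto simp: Q_def)
      then have "norm x * radius t \<le> radius s * radius t"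
        using E(4) by (intro mult_right_mono) (auto simp: radius_def)
      then show ?thesis using radius_dual[OF E(4)] by (simp add: s_def mult.commute)
    qed
    from fourier_modulated_indicator_ge[of "B j" "y j" "radius t", OF B(1) _ this]
    have "t / 2 \<le> cmod (fourier (indicator (B j)) x)" using B by (simp add: B_def)
    then have "t / 2 * a j \<le> cmod (fourier (indicator (B j)) x) * a j" using J(2)[OF that(1)] by (rule mult_right_mono)
    then show ?thesis using J(2)[OF that(1)] unfolding f_def fourier_cmult
      by (simp add: norm_mult mult.commute)
  qed
  \<comment> \<open>The 1/4 combines 1/2 from the phase estimate with 1/2 from Khintchine's
    inequality.\<close>
  have "ennreal (2 ^ card J) * \<rho> (\<lambda>x. ennreal (t / 4 * A) * indicator Q x)
    \<le> ennreal D * (\<Sum>T\<in>Pow J. \<rho> (\<lambda>x. ennreal (cmod (signed_sum (\<lambda>j. f j x) J T))))"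
  proof (rule averaged_fourier_bound[OF J(1)])
    show "integrable lebesgue (f j)" for j unfolding f_def using int by (intro integrable_mult_right) auto
    show "(\<lambda>x. ennreal (t / 4 * A) * indicator Q x) \<in> borel_measurable lebesgue" using Q by auto
    fix x
    show "ennreal (2 ^ card J) * (ennreal (t / 4 * A) * indicator Q x)
      \<le> ennreal (\<Sum>T\<in>Pow J. cmod (signed_sum (\<lambda>j. fourier (f j) x) J T))"
    proof (cases "x \<in> Q")
      case True
      have "t / 2 * A = sqrt (\<Sum>j\<in>J. (t / 2 * a j)\<^sup>2)"
        using E(4) unfolding A_def power_mult_distrib sum_distrib_left[symmetric] real_sqrt_mult by simp
      also have "\<dots> \<le> sqrt (\<Sum>j\<in>J. (cmod (fourier (f j) x))\<^sup>2)"
        using J(2) E(4) f_low True by (intro real_sqrt_le_mono sum_mono power_mono) auto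
      finally have "2 ^ card J * (t / 4 * A) \<le> 2 ^ card J * (sqrt (\<Sum>j\<in>J. (cmod (fourier (f j) x))\<^sup>2) / 2)"
        by (simp add: mult.commute)
      also have "\<dots> \<le> (\<Sum>T\<in>Pow J. cmod (signed_sum (\<lambda>j. fourier (f j) x) J T))"
        by (rule khintchine_first_moment[OF J(1)])
      finally show ?thesis using True A E(4) by (simp add: ennreal_mult[symmetric] ennreal_leI)
    qed simp
  qed
  also have "(\<Sum>T\<in>Pow J. \<rho> (\<lambda>x. ennreal (cmod (signed_sum (\<lambda>j. f j x) J T)))) = ennreal (2 ^ card J) * \<rho> (step_fun J a E)"
    unfolding f_def using J y by (subst cmod_signed_sum_disjoint)
      (auto simp: B_def[symmetric] card_Pow ennreal_power[symmetric] ennreal_numeral)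
  also have "\<rho> (\<lambda>x. ennreal (t / 4 * A) * indicator Q x) = ennreal (t / 4 * A * fund s)"
  proof -
    have "\<rho> (\<lambda>x. ennreal (t / 4 * A) * indicator Q x) = ennreal (t / 4 * A) * ennreal (fund s)"
      using E(4) A Q(1) s rho_indicator[OF Q] by (subst cmult) auto
    also have "\<dots> = ennreal (t / 4 * A * fund s)"
      using E(4) A fund_nonneg by (intro ennreal_mult[symmetric]) auto
    finally show ?thesis .
  qed
  finally have "ennreal (2 ^ card J) * ennreal (t / 4 * A * fund s) \<le> ennreal (2 ^ card J) * (ennreal D * \<rho> (step_fun J a E))"
    by (simp add: mult_ac)
  then show ?thesis
    by (subst (asm) ennreal_mult_le_mult_iff) (auto simp: A_def s_def)
qed

lemma exists_disjoint_family_volume: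
  assumes "finite J" "t > 0"
  obtains E :: "'i \<Rightarrow> 'a set" where "disjoint_family_on E J" "\<And>j. j \<in> J \<Longrightarrow> E j \<in> sets lebesgue"
    "\<And>j. j \<in> J \<Longrightarrow> emeasure lebesgue (E j) = ennreal t"
proof -
  obtain y :: "'i \<Rightarrow> 'a" where "disjoint_family_on (\<lambda>j. ball (y j) (radius t)) J"
    using separated_centres[OF assms(1)] by blast
  then show ?thesis using emeasure_ball_radius[of t] assms(2)
    by (intro that[of "\<lambda>j. ball (y j) (radius t)"]) (auto simp del: emeasure_completion)
qed

text \<open>Equal coefficients on \<open>N\<close> pieces of volume \<open>t\<close>. The case
  \<open>N = 1\<close> is a reflection inequality between dual volumes; the factor
  \<open>sqrt (real N)\<close> is the source of the square root growth.\<close>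

lemma fund_multiple_ge:
  assumes "t > 0"
  shows "t / 4 * sqrt (real N) * fund (dual_const / t) \<le> D * fund (real N * t)"
proof -
  obtain E :: "nat \<Rightarrow> 'a set" where E: "disjoint_family_on E {..<N}" "\<And>j. j \<in> {..<N} \<Longrightarrow> E j \<in> sets lebesgue"
    "\<And>j. j \<in> {..<N} \<Longrightarrow> emeasure lebesgue (E j) = ennreal t"
    using exists_disjoint_family_volume[of "{..<N}", OF _ assms] by blast
  have "emeasure lebesgue (\<Union>j<N. E j) = (\<Sum>j<N. emeasure lebesgue (E j))"
    using E by (intro sum_emeasure[symmetric]) auto
  also have "\<dots> = (\<Sum>j<N. ennreal t)" using E(3) by (intro sum.cong) auto
  also have "\<dots> = ennreal (real N * t)" using assms by (simp add: ennreal_mult ennreal_of_nat_eq_real_of_nat)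
  finally have "\<rho> (indicator (\<Union>j<N. E j)) = ennreal (fund (real N * t))"
    using E assms by (intro rho_indicator) auto
  then have "ennreal (t / 4 * sqrt (real N) * fund (dual_const / t)) \<le> ennreal D * ennreal (fund (real N * t))"
    using step_fun_ge_fund[OF _ _ E assms, of "\<lambda>_. 1"] E(1) by (simp add: step_fun_union)
  then show ?thesis using D_pos fund_nonneg by (simp add: ennreal_mult[symmetric])
qed

lemma fund_comparable_sqrt:
  obtains k1 k2 where "k1 > 0" "k2 > 0" "\<And>t. t > 0 \<Longrightarrow> k1 * sqrt t \<le> fund t" "\<And>t. t > 0 \<Longrightarrow> fund t \<le> k2 * sqrt t"
proof (rule sqrt_growth[of fund "dual_const / (16 * D\<^sup>2)" dual_const "4 * D"])
  have refl: "t * fund (dual_const / t) \<le> 4 * D * fund t" if "t > 0" for t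
    using fund_multiple_ge[OF that, of 1] by simp
  then show "\<And>t. t > 0 \<Longrightarrow> t * fund (dual_const / t) \<le> 4 * D * fund t" .
  fix N :: nat and t :: real assume t: "t > 0"
  \<comment> \<open>Reflecting at \<open>dual_const / t\<close> leads back to volume
    \<open>t\<close>; the two inequalities together cost the factor
    \<open>16 * D\<^sup>2\<close>.\<close>
  have "dual_const / t * fund t \<le> 4 * D * fund (dual_const / t)"
    using refl[of "dual_const / t"] t dual_const_pos by simp
  then have "t / 4 * sqrt (real N) * (dual_const / t * fund t) \<le> t / 4 * sqrt (real N) * (4 * D * fund (dual_const / t))"
    using t by (intro mult_left_mono) auto
  also have "\<dots> = 4 * D * (t / 4 * sqrt (real N) * fund (dual_const / t))" by simp
  also have "\<dots> \<le> 4 * D * (D * fund (real N * t))" using D_pos fund_multiple_ge[OF t, of N] by (intro mult_left_mono) auto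
  finally show "dual_const / (16 * D\<^sup>2) * sqrt (real N) * fund t \<le> fund (real N * t)"
    using t D_pos by (simp add: field_simps power2_eq_square)
qed (use D_pos dual_const_pos fund_mono fund_pos that in auto)

text \<open>Since \<open>t * sqrt (dual_const / t)\<close> is
  \<open>sqrt dual_const * sqrt t\<close>, the lower bound on \<open>fund\<close> at the dual volume
  turns \<open>step_fun_ge_fund\<close> into an estimate of the square norm by the norm in
  \<open>X\<close>.\<close>

lemma step_fun_lower:
  assumes J: "finite J" "\<And>j. j \<in> J \<Longrightarrow> a j \<ge> 0"
    and E: "disjoint_family_on E J" "\<And>j. j \<in> J \<Longrightarrow> E j \<in> sets lebesgue"
    "\<And>j. j \<in> J \<Longrightarrow> emeasure lebesgue (E j) = ennreal t" "t > 0"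
    and k: "\<And>t. t > 0 \<Longrightarrow> k * sqrt t \<le> fund t" "k > 0"
  shows "ennreal (k * sqrt dual_const / (4 * D) * sqrt (t * (\<Sum>j\<in>J. (a j)\<^sup>2))) \<le> \<rho> (step_fun J a E)"
proof -
  define A where "A = sqrt (\<Sum>j\<in>J. (a j)\<^sup>2)"
  have A: "A \<ge> 0" by (simp add: A_def sum_nonneg)
  have "k * sqrt dual_const / 4 * (sqrt t * A) = t / 4 * A * (k * sqrt (dual_const / t))"
  proof -
    have "t / sqrt t = sqrt t" using E(4) by (simp add: real_div_sqrt)
    then have "k * sqrt dual_const / 4 * ((t / sqrt t) * A) = k * sqrt dual_const / 4 * (sqrt t * A)" by simp
    then show ?thesis by (simp add: real_sqrt_divide mult_ac)
  qed
  also have "\<dots> \<le> t / 4 * A * fund (dual_const / t)"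
  proof (rule mult_left_mono)
    show "k * sqrt (dual_const / t) \<le> fund (dual_const / t)"
      by (rule k(1)) (simp add: E(4) dual_const_pos)
    show "0 \<le> t / 4 * A" using E(4) A by simp
  qed
  finally have "ennreal (k * sqrt dual_const / 4 * (sqrt t * A)) \<le> ennreal (t / 4 * A * fund (dual_const / t))"
    by (rule ennreal_leI)
  also have "\<dots> \<le> ennreal D * \<rho> (step_fun J a E)"
    unfolding A_def by (rule step_fun_ge_fund) (use J E in auto)
  finally have "ennreal (k * sqrt dual_const / 4 * (sqrt t * A)) \<le> ennreal D * \<rho> (step_fun J a E)" .
  moreover have "ennreal (k * sqrt dual_const / 4 * (sqrt t * A))
      = ennreal D * ennreal (k * sqrt dual_const / (4 * D) * sqrt (t * (\<Sum>j\<in>J. (a j)\<^sup>2)))"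
    using D_pos k(2) dual_const_pos A E(4)
    by (simp add: ennreal_mult[symmetric] real_sqrt_mult A_def)
  ultimately show ?thesis using D_pos by (simp add: ennreal_mult_le_mult_iff)
qed

text \<open>The roles are exchanged: the centres \<open>y j\<close> become frequencies, and a
  trigonometric polynomial on the dual ball \<open>Q\<close> has a transform that is large on each
  \<open>B j\<close>. The step function is thus dominated by an averaged transform, and only the
  norm of the polynomial remains to be bounded.\<close>

lemma step_fun_upper:
  assumes J: "finite J" "\<And>j. j \<in> J \<Longrightarrow> a j \<ge> 0"
    and E: "disjoint_family_on E J" "\<And>j. j \<in> J \<Longrightarrow> E j \<in> sets lebesgue"
    "\<And>j. j \<in> J \<Longrightarrow> emeasure lebesgue (E j) = ennreal t" "t > 0"
    and k: "\<And>t. t > 0 \<Longrightarrow> fund t \<le> k * sqrt t" "k > 0"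
  shows "\<rho> (step_fun J a E) \<le> ennreal (10 * D * k / sqrt dual_const * sqrt (t * (\<Sum>j\<in>J. (a j)\<^sup>2)))"
proof (cases "(\<Sum>j\<in>J. (a j)\<^sup>2) = 0")
  case True
  then have "step_fun J a E = (\<lambda>x. 0)"
    using J by (auto simp: step_fun_def sum_nonneg_eq_0_iff)
  then show ?thesis by (simp add: zero)
next
  case False
  obtain y where y: "disjoint_family_on (\<lambda>j. ball (y j) (radius t)) J"
    "\<rho> (step_fun J a E) = \<rho> (step_fun J a (\<lambda>j. ball (y j) (radius t)))"
    by (rule step_fun_balls[OF J(1) E])
  define B where "B j = ball (y j) (radius t)" for j
  define s where "s = dual_const / t"
  have s: "s > 0" using E dual_const_pos by (simp add: s_def)
  define Q where "Q = ball (0::'a) (radius s)"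
  have Q: "Q \<in> sets lebesgue" "emeasure lebesgue Q = ennreal s" "measure lebesgue Q = s"
    using s emeasure_ball_radius[of s 0] measure_ball_radius[of s 0] by (auto simp: Q_def)
  have [measurable]: "Q \<in> sets lebesgue" by fact
  define h where "h j = (\<lambda>x. indicator Q x * cis (2 * pi * (y j \<bullet> x)))" for j
  define f where "f j = (\<lambda>x. complex_of_real (a j) * h j x)" for j
  define A where "A = sqrt (\<Sum>j\<in>J. (a j)\<^sup>2)"
  have A: "A > 0" "A\<^sup>2 = (\<Sum>j\<in>J. (a j)\<^sup>2)" using False by (auto simp: A_def sum_nonneg less_le)
  have hm: "h j \<in> borel_measurable lebesgue" for j unfolding h_def by measurable
  have hint: "integrable lebesgue (h j)" for j
    using Q hm by (intro integrable_bounded_on_finite_measure[where E=Q and B=1])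
      (auto simp: h_def norm_mult simp del: emeasure_completion split: split_indicator)
  have f_low: "s / 2 * a j \<le> cmod (fourier (f j) x)" if "j \<in> J" "x \<in> B j" for j x
  proof -
    have "norm (x - y j) * radius s \<le> 1 / 6"
    proof -
      have "norm (x - y j) \<le> radius t" using that by (auto simp: B_def dist_norm norm_minus_commute)
      then have "norm (x - y j) * radius s \<le> radius t * radius s"
        using s by (intro mult_right_mono) (auto simp: radius_def)
      then show ?thesis using radius_dual[OF E(4)] by (simp add: s_def)
    qed
    from fourier_modulated_indicator_ge[of Q 0 "radius s", OF Q(1) _ this]
    have "s / 2 \<le> cmod (fourier (h j) x)" using Q by (simp add: Q_def h_def)
    then have "s / 2 * a j \<le> cmod (fourier (h j) x) * a j" using J(2)[OF that(1)] by (rule mult_right_mono)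
    then show ?thesis using J(2)[OF that(1)] unfolding f_def fourier_cmult
      by (simp add: norm_mult mult.commute)
  qed
  define S where "S T x = cmod (signed_sum (\<lambda>j. f j x) J T)" for T x
  have Sm: "S T \<in> borel_measurable lebesgue" for T
    unfolding S_def signed_sum_def f_def using hm by measurable
  have S0: "S T x = 0" if "x \<notin> Q" for T x
    using that by (auto simp: S_def signed_sum_def f_def h_def intro!: sum.neutral)
  have SM: "S T x \<le> (\<Sum>j\<in>J. a j)" for T x
    unfolding S_def signed_sum_def using J(2)
    by (intro sum_norm_le) (auto simp: f_def h_def norm_mult split: split_indicator)
  \<comment> \<open>On \<open>Q\<close> the j-th term has modulus exactly \<open>a j\<close>, so the
    fourth moment bound is the same at every point of \<open>Q\<close>.\<close>
  have S4: "(\<Sum>T\<in>Pow J. S T x ^ 4) \<le> 2 ^ card J * (3 * A ^ 4) * indicator Q x" for x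
  proof (cases "x \<in> Q")
    case True
    have "(\<Sum>j\<in>J. (cmod (f j x))\<^sup>2) = A\<^sup>2" unfolding A(2) using True
      by (intro sum.cong) (auto simp: f_def h_def norm_mult)
    then have "(\<Sum>T\<in>Pow J. S T x ^ 4) \<le> 2 ^ card J * (3 * (A\<^sup>2)\<^sup>2)"
      unfolding S_def using signed_sum_fourth_moment[OF J(1), of "\<lambda>j. f j x"] by simp
    then show ?thesis using True by simp
  qed (simp add: S0)
  have S4int: "integrable lebesgue (\<lambda>x. S T x ^ 4)" for T
  proof (rule Bochner_Integration.integrable_bound[where f="\<lambda>x. (\<Sum>j\<in>J. a j) ^ 4 * indicator Q x :: real"])
    show "integrable lebesgue (\<lambda>x. (\<Sum>j\<in>J. a j) ^ 4 * indicator Q x :: real)"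
      using Q by (intro integrable_mult_right integrable_real_indicator) auto
    show "AE x in lebesgue. norm (S T x ^ 4) \<le> norm ((\<Sum>j\<in>J. a j) ^ 4 * indicator Q x :: real)"
      using SM[of T] S0[of _ T] by (intro AE_I2) (auto simp: S_def intro!: power_mono split: split_indicator)
  qed (use Sm in measurable)
  have "(\<Sum>T\<in>Pow J. (LINT x|lebesgue. S T x ^ 4)) = (LINT x|lebesgue. (\<Sum>T\<in>Pow J. S T x ^ 4))"
    using S4int by (intro Bochner_Integration.integral_sum[symmetric]) auto
  also have "\<dots> \<le> (LINT x|lebesgue. 2 ^ card J * (3 * A ^ 4) * indicator Q x)"
    using S4int S4 Q by (intro integral_mono Bochner_Integration.integrable_sum integrable_mult_right integrable_real_indicator) auto
  also have "\<dots> = 2 ^ card J * (3 * A ^ 4) * s" using Q by simp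
  finally have SI: "(\<Sum>T\<in>Pow J. (LINT x|lebesgue. S T x ^ 4)) \<le> 2 ^ card J * (3 * A ^ 4) * s" .
  \<comment> \<open>On \<open>B j\<close> only the j-th transform is known to be large, so the
    single-term first moment bound is the one used.\<close>
  have avg: "ennreal (2 ^ card J) * \<rho> (\<lambda>x. ennreal (s / 2) * step_fun J a B x)
    \<le> ennreal D * (\<Sum>T\<in>Pow J. \<rho> (\<lambda>x. ennreal (cmod (signed_sum (\<lambda>j. f j x) J T))))"
  proof (rule averaged_fourier_bound[OF J(1)])
    show "integrable lebesgue (f j)" for j unfolding f_def using hint by (intro integrable_mult_right) auto
    have "step_fun J a B \<in> borel_measurable lebesgue" by (rule step_fun_measurable) (simp add: B_def)
    then show "(\<lambda>x. ennreal (s / 2) * step_fun J a B x) \<in> borel_measurable lebesgue" by measurable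
    fix x
    show "ennreal (2 ^ card J) * (ennreal (s / 2) * step_fun J a B x)
      \<le> ennreal (\<Sum>T\<in>Pow J. cmod (signed_sum (\<lambda>j. fourier (f j) x) J T))"
    proof (cases "\<exists>j\<in>J. x \<in> B j")
      case True
      then obtain j where j: "j \<in> J" "x \<in> B j" by blast
      have "2 ^ card J * (s / 2 * a j) \<le> 2 ^ card J * cmod (fourier (f j) x)"
        using f_low[OF j] by simp
      also have "\<dots> \<le> (\<Sum>T\<in>Pow J. cmod (signed_sum (\<lambda>j. fourier (f j) x) J T))"
        using signed_sum_first_moment_ge_term[OF J(1) j(1), of "\<lambda>j. fourier (f j) x"] .
      finally show ?thesis using s J(2)[OF j(1)] step_fun_on[of J B j x a] j J(1) y(1)
        by (simp add: B_def[symmetric] ennreal_mult[symmetric] ennreal_leI)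
    next
      case False
      then show ?thesis using step_fun_off[of x B J a] by simp
    qed
  qed
  \<comment> \<open>The threshold \<open>A\<close> is the root mean square of the polynomial on
    \<open>Q\<close>; it makes both terms of the fourth moment bound of order
    \<open>A * sqrt s\<close>.\<close>
  have "(\<Sum>T\<in>Pow J. \<rho> (\<lambda>x. ennreal (cmod (signed_sum (\<lambda>j. f j x) J T))))
      \<le> (\<Sum>T\<in>Pow J. ennreal (k * (2 * A * sqrt s + (LINT x|lebesgue. S T x ^ 4) / (A ^ 3 * sqrt s))))"
    using fourth_moment_bound[OF k Q(1,2) s Sm _ S0 SM A(1)] by (intro sum_mono) (simp add: S_def)
  also have "\<dots> = ennreal (\<Sum>T\<in>Pow J. k * (2 * A * sqrt s + (LINT x|lebesgue. S T x ^ 4) / (A ^ 3 * sqrt s)))"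
    using k(2) A s by (intro sum_ennreal) (auto intro!: mult_nonneg_nonneg add_nonneg_nonneg divide_nonneg_nonneg integral_nonneg simp: S_def)
  also have "(\<Sum>T\<in>Pow J. k * (2 * A * sqrt s + (LINT x|lebesgue. S T x ^ 4) / (A ^ 3 * sqrt s)))
      = k * (2 ^ card J * (2 * A * sqrt s) + (\<Sum>T\<in>Pow J. (LINT x|lebesgue. S T x ^ 4)) / (A ^ 3 * sqrt s))"
    using J(1) by (simp add: sum_distrib_left[symmetric] sum.distrib sum_divide_distrib[symmetric] card_Pow)
  also have "ennreal \<dots> \<le> ennreal (k * (2 ^ card J * (2 * A * sqrt s) + 2 ^ card J * (3 * A ^ 4) * s / (A ^ 3 * sqrt s)))"
    using SI k(2) A s by (intro ennreal_leI mult_left_mono add_left_mono divide_right_mono) auto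
  \<comment> \<open>The 5 is 2 from the threshold term plus 3 from the fourth moment; dividing by
    \<open>s / 2\<close> below makes it 10.\<close>
  also have "k * (2 ^ card J * (2 * A * sqrt s) + 2 ^ card J * (3 * A ^ 4) * s / (A ^ 3 * sqrt s)) = 2 ^ card J * (5 * k * A * sqrt s)"
  proof -
    have "s / sqrt s = sqrt s" using s by (simp add: real_div_sqrt)
    moreover have "A ^ 4 / A ^ 3 = A" using A by (simp add: power_diff[symmetric])
    moreover have "2 ^ card J * (3 * A ^ 4) * s / (A ^ 3 * sqrt s) = 2 ^ card J * 3 * (A ^ 4 / A ^ 3) * (s / sqrt s)" by simp
    ultimately show ?thesis by (simp add: algebra_simps)
  qed
  finally have "ennreal D * (\<Sum>T\<in>Pow J. \<rho> (\<lambda>x. ennreal (cmod (signed_sum (\<lambda>j. f j x) J T))))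
      \<le> ennreal D * ennreal (2 ^ card J * (5 * k * A * sqrt s))" by (rule mult_left_mono) simp
  moreover have "\<rho> (\<lambda>x. ennreal (s / 2) * step_fun J a B x) = ennreal (s / 2) * \<rho> (step_fun J a E)"
    unfolding y(2) B_def[abs_def] using s by (intro cmult step_fun_measurable) auto
  ultimately have "ennreal (2 ^ card J) * (ennreal (s / 2) * \<rho> (step_fun J a E)) \<le> ennreal D * ennreal (2 ^ card J * (5 * k * A * sqrt s))"
    using avg by simp
  also have "\<dots> = ennreal (2 ^ card J) * (ennreal (s / 2) * ennreal (10 * D * k / sqrt dual_const * sqrt (t * (\<Sum>j\<in>J. (a j)\<^sup>2))))"
  proof -
    have st: "sqrt t = sqrt dual_const / sqrt s"
      using E(4) dual_const_pos by (simp add: s_def real_sqrt_divide)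
    have "s / 2 * (10 * D * k / sqrt dual_const * (sqrt t * A)) = D * (5 * k * A * (s / sqrt s))"
      unfolding st using dual_const_pos by simp
    also have "s / sqrt s = sqrt s" using s by (simp add: real_div_sqrt)
    finally have "D * (2 ^ card J * (5 * k * A * sqrt s)) = 2 ^ card J * (s / 2 * (10 * D * k / sqrt dual_const * (sqrt t * A)))"
      by (simp only: mult_ac)
    moreover have "sqrt (t * (\<Sum>j\<in>J. (a j)\<^sup>2)) = sqrt t * A" by (simp add: A_def real_sqrt_mult)
    ultimately show ?thesis using D_pos k(2) A s E(4) dual_const_pos
      by (simp only: ennreal_mult[symmetric]) (simp add: ennreal_mult[symmetric])
  qed
  finally have "ennreal (s / 2) * \<rho> (step_fun J a E)
      \<le> ennreal (s / 2) * ennreal (10 * D * k / sqrt dual_const * sqrt (t * (\<Sum>j\<in>J. (a j)\<^sup>2)))"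
    by (subst (asm) ennreal_mult_le_mult_iff) auto
  then show ?thesis using s by (subst (asm) ennreal_mult_le_mult_iff) auto
qed

end

section \<open>Comparison with the square norm\<close>

text \<open>Prescribing the measure instead of a radius avoids a choice of radius and makes the cuts
  nested in \<open>m\<close>.\<close>

definition radial_cut :: "'a::euclidean_space set \<Rightarrow> real \<Rightarrow> 'a set" where
  "radial_cut G m = {x \<in> G. measure lebesgue (G \<inter> ball 0 (norm x)) < m}"

text \<open>The measure of \<open>G\<close> inside a ball grows no faster with the radius than the
  volume of the ball, so it is continuous and takes the value \<open>m\<close>.\<close>

lemma radial_cut_eq_ball:
  fixes G :: "'a::euclidean_space set"
  assumes G: "G \<in> sets lebesgue" "G \<subseteq> ball 0 R" and m: "0 \<le> m" "m \<le> measure lebesgue G"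
  obtains s where "radial_cut G m = G \<inter> ball 0 s" "measure lebesgue (G \<inter> ball 0 s) = m"
proof -
  define H where "H s = measure lebesgue (G \<inter> ball 0 s)" for s
  define P where "P s = measure lebesgue (ball (0::'a) s)" for s
  define r where "r = max R 0"
  have lm: "G \<inter> ball 0 s \<in> lmeasurable" for s
    using G(1) fmeasurable_Int_fmeasurable[OF lmeasurable_ball[of 0 s] G(1)] by (simp add: Int_commute)
  have Hmono: "H s \<le> H s'" if "s \<le> s'" for s s'
    unfolding H_def using that lm by (intro measure_mono_fmeasurable) auto
  have HP: "H s' - H s \<le> P s' - P s" if "s \<le> s'" for s s'
  proof -
    have "H s' - H s = measure lebesgue ((G \<inter> ball 0 s') - (G \<inter> ball 0 s))"
      unfolding H_def using that lm by (subst measurable_measure_Diff) auto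
    also have "\<dots> \<le> measure lebesgue (ball 0 s' - ball (0::'a) s)"
      using lm by (intro measure_mono_fmeasurable) auto
    also have "\<dots> = P s' - P s"
      unfolding P_def using that by (subst measurable_measure_Diff) auto
    finally show ?thesis .
  qed
  have Pc: "continuous_on {0..r} P"
  proof (rule continuous_on_eq)
    show "continuous_on {0..r} (\<lambda>s. unit_ball_vol DIM('a) * s ^ DIM('a))" by (intro continuous_intros)
    show "unit_ball_vol DIM('a) * s ^ DIM('a) = P s" if "s \<in> {0..r}" for s
      using that content_ball[of s "0::'a"] by (simp add: P_def)
  qed
  have Hc: "continuous_on {0..r} H"
    unfolding continuous_on_def
  proof
    fix s assume "s \<in> {0..r}"
    then have "(P \<longlongrightarrow> P s) (at s within {0..r})" using Pc by (auto simp: continuous_on_def)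
    then have "((\<lambda>s'. P s' - P s) \<longlongrightarrow> 0) (at s within {0..r})" by (simp add: LIM_zero_iff)
    then have lim: "((\<lambda>s'. norm (P s' - P s)) \<longlongrightarrow> 0) (at s within {0..r})" by (rule tendsto_norm_zero)
    have "norm (H s' - H s) \<le> norm (P s' - P s)" for s'
      using HP[of s s'] HP[of s' s] Hmono[of s s'] Hmono[of s' s] by (cases "s \<le> s'") auto
    then have "((\<lambda>s'. H s' - H s) \<longlongrightarrow> 0) (at s within {0..r})"
      by (intro Lim_null_comparison[OF always_eventually lim]) auto
    then show "(H \<longlongrightarrow> H s) (at s within {0..r})" by (simp add: LIM_zero_iff)
  qed
  have "G \<inter> ball 0 r = G" using G(2) by (auto simp: r_def)
  then have "H r = measure lebesgue G" by (simp add: H_def)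
  moreover have "H 0 = 0" by (simp add: H_def)
  ultimately obtain s0 where s0: "0 \<le> s0" "s0 \<le> r" "H s0 = m"
    using IVT'[of H 0 m r] m Hc by (auto simp: r_def)
  \<comment> \<open>\<open>H\<close> may equal \<open>m\<close> on a whole interval of radii; the
    strict inequality in \<open>radial_cut\<close> selects the smallest, which exists by
    compactness.\<close>
  define S where "S = {s \<in> {0..r}. H s = m}"
  have "closed S" unfolding S_def by (intro continuous_closed_preimage_constant Hc closed_atLeastAtMost)
  moreover have "bounded S" by (rule bounded_subset[of "{0..r}"]) (auto simp: S_def)
  ultimately have "compact S" unfolding compact_eq_bounded_closed by blast
  have "s0 \<in> S" using s0 by (simp add: S_def)
  then have "S \<noteq> {}" by blast
  obtain s where s: "s \<in> S" "\<And>s'. s' \<in> S \<Longrightarrow> s \<le> s'"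
    using compact_attains_inf[OF \<open>compact S\<close> \<open>S \<noteq> {}\<close>] by blast
  have "0 \<le> s" "s \<le> r" "H s = m" using s(1) by (auto simp: S_def)
  have "H s' < m \<longleftrightarrow> s' < s" if "s' \<ge> 0" for s'
  proof
    assume "H s' < m"
    then show "s' < s" using Hmono[of s s'] \<open>H s = m\<close> by linarith
  next
    assume less: "s' < s"
    then have "s' \<notin> S" using s(2) by force
    then have "H s' \<noteq> m" using that less \<open>s \<le> r\<close> by (simp add: S_def)
    moreover have "H s' \<le> m" using Hmono[of s' s] less \<open>H s = m\<close> by simp
    ultimately show "H s' < m" by simp
  qed
  then have "radial_cut G m = G \<inter> ball 0 s"
    by (auto simp: radial_cut_def H_def[symmetric])
  moreover have "measure lebesgue (G \<inter> ball 0 s) = m" using s(1) by (simp add: S_def H_def)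
  ultimately show ?thesis by (rule that)
qed

lemma radial_cut_measure:
  fixes G :: "'a::euclidean_space set"
  assumes "G \<in> sets lebesgue" "G \<subseteq> ball 0 R" "0 \<le> m" "m \<le> measure lebesgue G"
  shows "radial_cut G m \<in> lmeasurable" "measure lebesgue (radial_cut G m) = m"
proof -
  obtain s where s: "radial_cut G m = G \<inter> ball 0 s" "measure lebesgue (G \<inter> ball 0 s) = m"
    using radial_cut_eq_ball[OF assms] by blast
  have "G \<inter> ball 0 s \<in> lmeasurable"
    using fmeasurable_Int_fmeasurable[OF lmeasurable_ball[of 0 s] assms(1)] by (simp add: Int_commute)
  then show "radial_cut G m \<in> lmeasurable" "measure lebesgue (radial_cut G m) = m" using s by auto
qed

lemma ennreal_SUP_power2:
  fixes a :: "nat \<Rightarrow> ennreal"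
  assumes "incseq a"
  shows "(SUP k. (a k)\<^sup>2) = (SUP k. a k)\<^sup>2"
proof (rule antisym)
  show "(SUP k. (a k)\<^sup>2) \<le> (SUP k. a k)\<^sup>2"
    by (intro SUP_least power_mono SUP_upper) auto
  have "(SUP k. a k)\<^sup>2 = (SUP k. SUP l. a l * a k)"
    by (simp add: power2_eq_square SUP_mult_left_ennreal SUP_mult_right_ennreal)
  also have "\<dots> \<le> (SUP k. (a k)\<^sup>2)"
  proof (intro SUP_least)
    fix k l
    have "a l * a k \<le> (a (max k l))\<^sup>2"
      unfolding power2_eq_square using assms by (intro mult_mono) (auto simp: incseq_def)
    also have "\<dots> \<le> (SUP k. (a k)\<^sup>2)" by (rule SUP_upper) simp
    finally show "a l * a k \<le> (SUP k. (a k)\<^sup>2)" .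
  qed
  finally show "(SUP k. a k)\<^sup>2 \<le> (SUP k. (a k)\<^sup>2)" .
qed

lemma nn_integral_step_fun_power2:
  assumes "finite J" "disjoint_family_on E J" "\<And>j. j \<in> J \<Longrightarrow> E j \<in> sets M" "\<And>j. j \<in> J \<Longrightarrow> a j \<ge> 0"
    "\<And>j. j \<in> J \<Longrightarrow> emeasure M (E j) = ennreal t" "t \<ge> 0"
  shows "(\<integral>\<^sup>+x. (step_fun J a E x)\<^sup>2 \<partial>M) = ennreal (t * (\<Sum>j\<in>J. (a j)\<^sup>2))"
proof -
  have "(step_fun J a E x)\<^sup>2 = (\<Sum>j\<in>J. ennreal ((a j)\<^sup>2) * indicator (E j) x)" for x
  proof (cases "\<exists>j\<in>J. x \<in> E j")
    case True
    then obtain j where j: "j \<in> J" "x \<in> E j" by blast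
    have "(\<Sum>j\<in>J. ennreal ((a j)\<^sup>2) * indicator (E j) x) = step_fun J (\<lambda>j. (a j)\<^sup>2) E x" by (simp add: step_fun_def)
    then show ?thesis using assms(4)[OF j(1)] step_fun_on[OF assms(1,2) j, of a] step_fun_on[OF assms(1,2) j, of "\<lambda>j. (a j)\<^sup>2"]
      by (simp add: ennreal_power)
  next
    case False
    then have "step_fun J a E x = 0" by (intro step_fun_off) auto
    moreover have "(\<Sum>j\<in>J. ennreal ((a j)\<^sup>2) * indicator (E j) x) = 0" using False by (intro sum.neutral) auto
    ultimately show ?thesis by simp
  qed
  then have "(\<integral>\<^sup>+x. (step_fun J a E x)\<^sup>2 \<partial>M) = (\<Sum>j\<in>J. ennreal ((a j)\<^sup>2) * emeasure M (E j))"
    using assms(3) by (simp add: nn_integral_sum nn_integral_cmult_indicator)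
  also have "\<dots> = (\<Sum>j\<in>J. ennreal ((a j)\<^sup>2 * t))"
    using assms(5,6) by (intro sum.cong) (auto simp: ennreal_mult)
  also have "\<dots> = ennreal (t * (\<Sum>j\<in>J. (a j)\<^sup>2))"
    using assms(6) by (simp add: sum_distrib_left mult.commute)
  finally show ?thesis .
qed

section \<open>From step functions to measurable functions\<close>

context ri_function_norm
begin

text \<open>Equivalence with the square norm, phrased through real bounds \<open>I\<close> and
  \<open>R\<close> to avoid square roots of possibly infinite integrals. Here \<open>c1\<close>
  bounds the square norm by \<open>\<rho>\<close>, and \<open>c2\<close> bounds
  \<open>\<rho>\<close> by the square norm.\<close>

definition L2_comparable :: "real \<Rightarrow> real \<Rightarrow> ('a \<Rightarrow> ennreal) \<Rightarrow> bool" where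
  "L2_comparable c1 c2 F \<longleftrightarrow>
    (\<forall>I\<ge>0. (\<integral>\<^sup>+x. (F x)\<^sup>2 \<partial>lebesgue) \<le> ennreal (I\<^sup>2) \<longrightarrow> \<rho> F \<le> ennreal (c2 * I)) \<and>
    (\<forall>R\<ge>0. \<rho> F \<le> ennreal R \<longrightarrow> (\<integral>\<^sup>+x. (F x)\<^sup>2 \<partial>lebesgue) \<le> ennreal ((c1 * R)\<^sup>2))"

text \<open>One half passes to the limit by the monotone convergence axiom for
  \<open>\<rho>\<close>, the other by monotone convergence of integrals.\<close>

lemma L2_comparable_SUP:
  assumes F: "\<And>k. F k \<in> borel_measurable lebesgue" "f \<in> borel_measurable lebesgue"
    and ae: "AE x in lebesgue. incseq (\<lambda>k. F k x) \<and> (SUP k. F k x) = f x"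
    and cmp: "\<And>k. L2_comparable c1 c2 (F k)"
  shows "L2_comparable c1 c2 f"
  unfolding L2_comparable_def
proof (intro conjI allI impI)
  have le: "AE x in lebesgue. F k x \<le> f x" for k
    using ae by eventually_elim (metis SUP_upper UNIV_I)
  {
    fix I :: real assume I: "0 \<le> I" "(\<integral>\<^sup>+x. (f x)\<^sup>2 \<partial>lebesgue) \<le> ennreal (I\<^sup>2)"
    have "\<rho> (F k) \<le> ennreal (c2 * I)" for k
    proof -
      have "(\<integral>\<^sup>+x. (F k x)\<^sup>2 \<partial>lebesgue) \<le> (\<integral>\<^sup>+x. (f x)\<^sup>2 \<partial>lebesgue)"
        by (rule nn_integral_mono_AE) (use le[of k] in \<open>auto elim!: eventually_mono intro: power_mono\<close>)
      then show ?thesis using cmp[of k] I unfolding L2_comparable_def by (meson order_trans)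
    qed
    then show "\<rho> f \<le> ennreal (c2 * I)"
      using SUP_AE[OF F ae] by (metis SUP_least)
  }
  {
    fix R :: real assume R: "0 \<le> R" "\<rho> f \<le> ennreal R"
    have k: "(\<integral>\<^sup>+x. (F k x)\<^sup>2 \<partial>lebesgue) \<le> ennreal ((c1 * R)\<^sup>2)" for k
    proof -
      have "\<rho> (F k) \<le> \<rho> f" using F le by (intro mono_AE) auto
      then show ?thesis using cmp[of k] R unfolding L2_comparable_def by (meson order_trans)
    qed
    have "(\<integral>\<^sup>+x. (f x)\<^sup>2 \<partial>lebesgue) = (\<integral>\<^sup>+x. (SUP k. (F k x)\<^sup>2) \<partial>lebesgue)"
    proof (rule nn_integral_cong_AE)
      show "AE x in lebesgue. (f x)\<^sup>2 = (SUP k. (F k x)\<^sup>2)"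
        using ae by eventually_elim (simp add: ennreal_SUP_power2)
    qed
    also have "\<dots> = (SUP k. \<integral>\<^sup>+x. (F k x)\<^sup>2 \<partial>lebesgue)"
    proof (rule nn_integral_monotone_convergence_SUP_AE)
      show "AE x in lebesgue. (F i x)\<^sup>2 \<le> (F (Suc i) x)\<^sup>2" for i
        using ae by eventually_elim (auto intro!: power_mono simp: incseq_Suc_iff)
    qed (use F in measurable)
    also have "\<dots> \<le> ennreal ((c1 * R)\<^sup>2)" using k by (rule SUP_least)
    finally show "(\<integral>\<^sup>+x. (f x)\<^sup>2 \<partial>lebesgue) \<le> ennreal ((c1 * R)\<^sup>2)" .
  }
qed

end

text \<open>On each level set \<open>G\<close> the function \<open>x \<mapsto> \<bar>G \<inter> ball 0 \<bar>x\<bar>\<bar>\<close> is uniformly distributed, so its dyadic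
  level sets are pieces of equal measure. Halving the step makes the covered part increase, and it exhausts
  \<open>G\<close> up to a null set.\<close>

lemma (in ri_function_norm) L2_comparable_simple_function:
  assumes step: "\<And>(J :: (ennreal \<times> nat) set) a E t. finite J \<Longrightarrow> (\<And>j. j \<in> J \<Longrightarrow> a j \<ge> 0) \<Longrightarrow>
      disjoint_family_on E J \<Longrightarrow> (\<And>j. j \<in> J \<Longrightarrow> E j \<in> sets lebesgue) \<Longrightarrow>
      (\<And>j. j \<in> J \<Longrightarrow> emeasure lebesgue (E j) = ennreal t) \<Longrightarrow> t > 0 \<Longrightarrow> L2_comparable c1 c2 (step_fun J a E)"
    and g: "simple_function lebesgue g" "\<And>x. g x < top" "\<And>x. x \<notin> ball 0 R \<Longrightarrow> g x = 0"
  shows "L2_comparable c1 c2 g"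
proof -
  define V where "V = range g - {0}"
  define G where "G v = g -` {v}" for v
  define u where "u x = measure lebesgue (G (g x) \<inter> ball 0 (norm x))" for x
  define t :: "nat \<Rightarrow> real" where "t k = (1 / 2) ^ k" for k
  \<comment> \<open>Only whole cells of measure \<open>t k\<close> are kept. The rest of the level
    set has measure less than \<open>t k\<close>, and \<open>P k\<close> vanishes there.\<close>
  define N where "N k v = nat \<lfloor>measure lebesgue (G v) / t k\<rfloor>" for k v
  define J where "J k = Sigma V (\<lambda>v. {..<N k v})" for k
  define a :: "ennreal \<times> nat \<Rightarrow> real" where "a p = enn2real (fst p)" for p
  define E where "E k p = radial_cut (G (fst p)) (real (Suc (snd p)) * t k) - radial_cut (G (fst p)) (real (snd p) * t k)"
    for k and p :: "ennreal \<times> nat"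
  define P where "P k = step_fun (J k) a (E k)" for k
  have t: "t k > 0" for k by (simp add: t_def)
  have finV: "finite V" using simple_functionD(1)[OF g(1)] by (simp add: V_def)
  have finJ: "finite (J k)" for k using finV by (simp add: J_def)
  have G: "G v \<in> sets lebesgue" for v using simple_functionD(2)[OF g(1), of "{v}"] by (simp add: G_def)
  have GR: "G v \<subseteq> ball 0 R" if "v \<in> V" for v using that g(3) by (force simp: G_def V_def)
  have N: "real (N k v) * t k \<le> measure lebesgue (G v)" "measure lebesgue (G v) < (real (N k v) + 1) * t k" for k v
  proof -
    have "real (N k v) \<le> measure lebesgue (G v) / t k" "measure lebesgue (G v) / t k < real (N k v) + 1"
      using t[of k] by (auto simp: N_def)
    then show "real (N k v) * t k \<le> measure lebesgue (G v)" "measure lebesgue (G v) < (real (N k v) + 1) * t k"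
      using t[of k] by (auto simp: field_simps)
  qed
  have mem: "x \<in> E k (v, j) \<longleftrightarrow> g x = v \<and> real j * t k \<le> u x \<and> u x < real (Suc j) * t k" for x k v j
    by (auto simp: E_def radial_cut_def G_def u_def not_less)
  have disj: "disjoint_family_on (E k) (J k)" for k
  proof -
    have "E k p \<inter> E k q = {}" if "p \<noteq> q" for p q
    proof (rule ccontr)
      assume "E k p \<inter> E k q \<noteq> {}"
      then obtain x where "x \<in> E k (fst p, snd p)" "x \<in> E k (fst q, snd q)" by auto
      then have "fst p = fst q" "real (snd p) * t k < real (Suc (snd q)) * t k" "real (snd q) * t k < real (Suc (snd p)) * t k"
        unfolding mem by auto
      then have "fst p = fst q" "snd p = snd q" using t[of k] by auto
      then show False using that by (simp add: prod_eq_iff)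
    qed
    then show ?thesis by (auto simp: disjoint_family_on_def)
  qed
  have E: "E k p \<in> lmeasurable" "measure lebesgue (E k p) = t k" if "p \<in> J k" for k p
  proof -
    define v where "v = fst p"
    define j where "j = snd p"
    have p: "p = (v, j)" "v \<in> V" "j < N k v" using that by (auto simp: J_def v_def j_def)
    have "real (Suc j) * t k \<le> real (N k v) * t k" using p t[of k] by (intro mult_right_mono) auto
    then have j: "real (Suc j) * t k \<le> measure lebesgue (G v)" using N(1)[of k v] by linarith
    have j': "real j * t k \<le> measure lebesgue (G v)"
      using j t[of k] mult_right_mono[of "real j" "real (Suc j)" "t k"] by linarith
    note c = radial_cut_measure[OF G GR[OF p(2)] _ j] radial_cut_measure[OF G GR[OF p(2)] _ j']
    have sub: "radial_cut (G v) (real j * t k) \<subseteq> radial_cut (G v) (real (Suc j) * t k)"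
    proof -
      have "real j * t k \<le> real (Suc j) * t k" using t[of k] by (intro mult_right_mono) auto
      then show ?thesis unfolding radial_cut_def by force
    qed
    show "E k p \<in> lmeasurable" unfolding E_def p(1) fst_conv snd_conv
      using c t[of k] by (intro fmeasurable.Diff) auto
    have "measure lebesgue (E k p) = real (Suc j) * t k - real j * t k"
      unfolding E_def p(1) fst_conv snd_conv using c t[of k] sub
      by (subst measurable_measure_Diff) (auto simp del: of_nat_Suc)
    then show "measure lebesgue (E k p) = t k" by (simp add: algebra_simps)
  qed
  have eE: "emeasure lebesgue (E k p) = ennreal (t k)" if "p \<in> J k" for k p
    using E[OF that] by (simp add: emeasure_eq_measure2 del: emeasure_completion)
  have P_on: "P k x = g x" if "g x \<noteq> 0" "u x < real (N k (g x)) * t k" for k x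
  proof -
    define j where "j = nat \<lfloor>u x / t k\<rfloor>"
    have u0: "u x / t k \<ge> 0" using t[of k] by (simp add: u_def)
    have "real j \<le> u x / t k" "u x / t k < real j + 1" using u0 by (auto simp: j_def)
    then have j: "real j * t k \<le> u x" "u x < real (Suc j) * t k" using t[of k] by (auto simp: field_simps)
    have "real j * t k < real (N k (g x)) * t k" using j that by linarith
    then have "j < N k (g x)" using t[of k] by auto
    then have "(g x, j) \<in> J k" using that by (auto simp: J_def V_def)
    moreover have "x \<in> E k (g x, j)" using j by (simp add: mem del: of_nat_Suc)
    ultimately have "P k x = ennreal (a (g x, j))" unfolding P_def by (intro step_fun_on finJ disj)
    then show ?thesis using g(2)[of x] by (simp add: a_def)
  qed
  have P_off: "P k x = 0" if "\<not> (g x \<noteq> 0 \<and> u x < real (N k (g x)) * t k)" for k x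
    unfolding P_def
  proof (rule step_fun_off, rule notI)
    assume "x \<in> (\<Union>p\<in>J k. E k p)"
    then obtain v j where vj: "v \<in> V" "j < N k v" "x \<in> E k (v, j)" by (auto simp: J_def)
    then have "g x = v" "u x < real (Suc j) * t k" by (auto simp: mem)
    moreover have "real (Suc j) * t k \<le> real (N k v) * t k" using vj t[of k] by (intro mult_right_mono) auto
    ultimately show False using that vj(1) by (auto simp: V_def)
  qed
  have Nmono: "real (N k v) * t k \<le> real (N (Suc k) v) * t (Suc k)" for k v
  proof -
    have "2 * N k v \<le> N (Suc k) v"
    proof -
      have "real (2 * N k v) \<le> measure lebesgue (G v) / t (Suc k)"
        using N(1)[of k v] t[of k] by (simp add: t_def field_simps)
      then show ?thesis by (simp add: N_def le_nat_floor)
    qed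
    then have "real (2 * N k v) * t (Suc k) \<le> real (N (Suc k) v) * t (Suc k)"
      using t[of "Suc k"] by (intro mult_right_mono) (simp_all del: of_nat_mult)
    then show ?thesis by (simp add: t_def)
  qed
  have inc: "incseq (\<lambda>k. P k x)" for x
  proof (rule incseq_SucI)
    fix k
    show "P k x \<le> P (Suc k) x"
    proof (cases "g x \<noteq> 0 \<and> u x < real (N k (g x)) * t k")
      case True
      then have "u x < real (N (Suc k) (g x)) * t (Suc k)" using Nmono[of k "g x"] by linarith
      then show ?thesis using True by (simp add: P_on)
    qed (simp add: P_off)
  qed
  have null: "(\<Union>v\<in>V. G v - radial_cut (G v) (measure lebesgue (G v))) \<in> null_sets lebesgue"
  proof (rule null_sets_UN')
    show "countable V" using finV by (rule countable_finite)
    fix v assume v: "v \<in> V"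
    note c = radial_cut_measure[OF G GR[OF v], of "measure lebesgue (G v)"]
    have Gl: "G v \<in> lmeasurable" using GR[OF v] G by (intro bounded_set_imp_lmeasurable bounded_subset[OF bounded_ball]) auto
    have "measure lebesgue (G v - radial_cut (G v) (measure lebesgue (G v))) = 0"
      using c Gl by (subst measurable_measure_Diff) (auto simp: radial_cut_def)
    moreover have "G v - radial_cut (G v) (measure lebesgue (G v)) \<in> lmeasurable"
      using c Gl by (intro fmeasurable.Diff) auto
    ultimately show "G v - radial_cut (G v) (measure lebesgue (G v)) \<in> null_sets lebesgue"
      by (auto simp: null_sets_def emeasure_eq_measure2 simp del: emeasure_completion)
  qed
  \<comment> \<open>Outside the null set \<open>u x\<close> lies strictly below the measure of the
    level set; once \<open>t k\<close> is smaller than this gap, \<open>x\<close> belongs to a whole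
    cell.\<close>
  have sup: "(SUP k. P k x) = g x" if "x \<notin> (\<Union>v\<in>V. G v - radial_cut (G v) (measure lebesgue (G v)))" for x
  proof (cases "g x = 0")
    case True
    then show ?thesis by (simp add: P_off)
  next
    case False
    have "u x < measure lebesgue (G (g x))" using that False by (auto simp: V_def G_def radial_cut_def u_def)
    then have "measure lebesgue (G (g x)) - u x > 0" by simp
    then obtain k where "t k < measure lebesgue (G (g x)) - u x"
      using real_arch_pow_inv[of "measure lebesgue (G (g x)) - u x" "1/2"] unfolding t_def by fastforce
    then have "u x < real (N k (g x)) * t k" using N(2)[of "g x" k] by (simp add: algebra_simps)
    then have k: "P k x = g x" using False by (rule P_on[rotated])
    show ?thesis
    proof (rule antisym)
      show "(SUP k. P k x) \<le> g x"
        by (rule SUP_least) (metis P_on P_off order_refl zero_le)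
      show "g x \<le> (SUP k. P k x)" using k by (metis SUP_upper UNIV_I)
    qed
  qed
  have ae: "AE x in lebesgue. incseq (\<lambda>k. P k x) \<and> (SUP k. P k x) = g x"
    using AE_not_in[OF null] by eventually_elim (use inc sup in blast)
  show ?thesis
  proof (rule L2_comparable_SUP[OF _ _ ae])
    show "P k \<in> borel_measurable lebesgue" for k unfolding P_def using E by (intro step_fun_measurable) auto
    show "g \<in> borel_measurable lebesgue" using g(1) by (rule borel_measurable_simple_function)
    show "L2_comparable c1 c2 (P k)" for k unfolding P_def
      by (rule step[where t="t k"]) (use finJ disj E eE t in \<open>auto simp: a_def simp del: emeasure_completion\<close>)
  qed
qed

context fourier_bounded
begin

lemma L2_comparable_step_fun:
  assumes k: "k1 > 0" "k2 > 0" "\<And>t. t > 0 \<Longrightarrow> k1 * sqrt t \<le> fund t" "\<And>t. t > 0 \<Longrightarrow> fund t \<le> k2 * sqrt t"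
    and J: "finite J" "\<And>j. j \<in> J \<Longrightarrow> a j \<ge> 0"
    and E: "disjoint_family_on E J" "\<And>j. j \<in> J \<Longrightarrow> E j \<in> sets lebesgue"
    "\<And>j. j \<in> J \<Longrightarrow> emeasure lebesgue (E j) = ennreal t" "t > 0"
  shows "L2_comparable (4 * D / (k1 * sqrt dual_const)) (10 * D * k2 / sqrt dual_const) (step_fun J a E)"
proof -
  define s where "s = t * (\<Sum>j\<in>J. (a j)\<^sup>2)"
  have s0: "s \<ge> 0" using E(4) by (simp add: s_def sum_nonneg)
  have int: "(\<integral>\<^sup>+x. (step_fun J a E x)\<^sup>2 \<partial>lebesgue) = ennreal s"
    unfolding s_def by (rule nn_integral_step_fun_power2) (use J E in auto)
  have lower: "ennreal (k1 * sqrt dual_const / (4 * D) * sqrt s) \<le> \<rho> (step_fun J a E)"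
    unfolding s_def by (rule step_fun_lower) (use J E k in auto)
  have upper: "\<rho> (step_fun J a E) \<le> ennreal (10 * D * k2 / sqrt dual_const * sqrt s)"
    unfolding s_def by (rule step_fun_upper) (use J E k in auto)
  show ?thesis unfolding L2_comparable_def int
  proof (intro conjI allI impI)
    fix I :: real assume I: "0 \<le> I" "ennreal s \<le> ennreal (I\<^sup>2)"
    then have "sqrt s \<le> I" using real_le_lsqrt[of I s] s0 by simp
    then have "10 * D * k2 / sqrt dual_const * sqrt s \<le> 10 * D * k2 / sqrt dual_const * I"
      using D_pos k dual_const_pos by (intro mult_left_mono) auto
    then show "\<rho> (step_fun J a E) \<le> ennreal (10 * D * k2 / sqrt dual_const * I)"
      using upper by (meson ennreal_leI order_trans)
  next
    fix R :: real assume R: "0 \<le> R" "\<rho> (step_fun J a E) \<le> ennreal R"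
    then have "ennreal (k1 * sqrt dual_const / (4 * D) * sqrt s) \<le> ennreal R" using lower by (meson order_trans)
    then have "k1 * sqrt dual_const / (4 * D) * sqrt s \<le> R" using R by simp
    then have "sqrt s \<le> 4 * D / (k1 * sqrt dual_const) * R"
      using D_pos k dual_const_pos by (simp add: field_simps)
    then have "(sqrt s)\<^sup>2 \<le> (4 * D / (k1 * sqrt dual_const) * R)\<^sup>2" using s0 by (intro power_mono) auto
    then show "ennreal s \<le> ennreal ((4 * D / (k1 * sqrt dual_const) * R)\<^sup>2)" using s0 by (simp add: ennreal_leI)
  qed
qed

lemma L2_comparable_measurable:
  obtains c1 c2 where "c1 > 0" "c2 > 0" "\<And>F. F \<in> borel_measurable lebesgue \<Longrightarrow> L2_comparable c1 c2 F"
proof -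
  obtain k1 k2 where k: "k1 > 0" "k2 > 0" "\<And>t. t > 0 \<Longrightarrow> k1 * sqrt t \<le> fund t" "\<And>t. t > 0 \<Longrightarrow> fund t \<le> k2 * sqrt t"
    using fund_comparable_sqrt by blast
  define c1 where "c1 = 4 * D / (k1 * sqrt dual_const)"
  define c2 where "c2 = 10 * D * k2 / sqrt dual_const"
  have "L2_comparable c1 c2 F" if F: "F \<in> borel_measurable lebesgue" for F
  proof -
    obtain f where f: "\<And>i. simple_function lebesgue (f i)" "incseq f" "\<And>i x. f i x < top" "\<And>x. (SUP i. f i x) = F x"
      using borel_measurable_implies_simple_function_sequence'[OF F] by metis
    \<comment> \<open>Cutting off to balls makes the non-zero level sets bounded, as radial cuts
      require.\<close>
    define g where "g i x = f i x * indicator (ball 0 (real i)) x" for i x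
    have gs: "simple_function lebesgue (g i)" for i
      unfolding g_def by (intro simple_function_mult f simple_function_indicator) auto
    have inc: "incseq (\<lambda>i. g i x)" for x
      using f(2) by (intro incseq_SucI) (auto simp: g_def incseq_Suc_iff le_fun_def split: split_indicator)
    have sup: "(SUP i. g i x) = F x" for x
    proof (rule antisym)
      show "(SUP i. g i x) \<le> F x"
        unfolding f(4)[symmetric] by (intro SUP_mono) (auto simp: g_def split: split_indicator)
      obtain n :: nat where n: "norm x < real n" using reals_Archimedean2 by blast
      show "F x \<le> (SUP i. g i x)" unfolding f(4)[symmetric]
      proof (rule SUP_mono)
        fix i
        have "f i x \<le> f (max i n) x" using f(2) by (auto simp: incseq_def le_fun_def)
        also have "\<dots> = g (max i n) x" using n by (auto simp: g_def)
        finally show "\<exists>m\<in>UNIV. f i x \<le> g m x" by blast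
      qed
    qed
    show ?thesis
    proof (rule L2_comparable_SUP[of g F])
      show "g i \<in> borel_measurable lebesgue" for i using gs by (rule borel_measurable_simple_function)
      show "AE x in lebesgue. incseq (\<lambda>k. g k x) \<and> (SUP k. g k x) = F x" using inc sup by simp
      show "L2_comparable c1 c2 (g i)" for i
      proof (rule L2_comparable_simple_function[OF _ gs, where R="real i"])
        show "g i x < top" for x using f(3) by (simp add: g_def split: split_indicator)
      qed (auto simp: g_def c1_def c2_def intro!: L2_comparable_step_fun[OF k] simp del: emeasure_completion)
    qed (rule F)
  qed
  moreover have "c1 > 0" "c2 > 0" using k D_pos dual_const_pos by (auto simp: c1_def c2_def)
  ultimately show ?thesis using that by blast
qed

end

section \<open>Bounds for the weight\<close>

text \<open>Two passes of the inequality, between dual scales \<open>d\<close> and \<open>1/(6d)\<close>, compare the weight on a ball around a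
  density point of \<open>{w \<le> a}\<close> with the weight on an equal ball around a density point of \<open>{w \<ge> b}\<close>.\<close>

lemma (in ri_function_norm) weight_oscillation:
  fixes w :: "'a \<Rightarrow> real"
  assumes w: "w \<in> borel_measurable lebesgue" "\<And>x. w x \<ge> 0"
    and C: "C > 0"
    and bound: "\<And>f. integrable lebesgue f \<Longrightarrow>
      \<rho> (\<lambda>x. ennreal (w x * cmod (fourier f x))) \<le> ennreal C * \<rho> (\<lambda>x. ennreal (w x * cmod (f x)))"
    and a: "a > 0" "emeasure lebesgue {x. w x \<le> a} > 0"
    and b: "b > 0" "emeasure lebesgue {x. w x \<ge> b} > 0"
  shows "b \<le> (16 * 6 ^ DIM('a) * C\<^sup>2 / (unit_ball_vol DIM('a))\<^sup>2) * a"
proof -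
  define A where "A = {x. w x \<le> a}"
  define B where "B = {x. w x \<ge> b}"
  have AB [measurable]: "A \<in> sets lebesgue" "B \<in> sets lebesgue"
    using borel_measurable_le[OF w(1), of "\<lambda>_. a"] borel_measurable_le[OF _ w(1), of "\<lambda>_. b"]
    by (auto simp: A_def B_def)
  have [measurable]: "w \<in> borel_measurable lebesgue" by fact
  obtain e1 where e1: "e1 > 0"
    "\<And>d. 0 < d \<Longrightarrow> d < e1 \<Longrightarrow> \<exists>y. emeasure lebesgue (ball y d) \<le> 2 * emeasure lebesgue (A \<inter> ball y d)"
    using half_density_small_balls[OF AB(1)] a(2) unfolding A_def by metis
  obtain e2 where e2: "e2 > 0"
    "\<And>d. 0 < d \<Longrightarrow> d < e2 \<Longrightarrow> \<exists>y. emeasure lebesgue (ball y d) \<le> 2 * emeasure lebesgue (B \<inter> ball y d)"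
    using half_density_small_balls[OF AB(2)] b(2) unfolding B_def by metis
  \<comment> \<open>Both passes use one pair of dual scales, so the two density statements are taken
    at the same radius.\<close>
  define d where "d = min e1 e2 / 2"
  have d: "d > 0" "d < e1" "d < e2" using e1(1) e2(1) by (auto simp: d_def)
  obtain y where y: "emeasure lebesgue (ball y d) \<le> 2 * emeasure lebesgue (A \<inter> ball y d)" using e1 d by blast
  obtain z where z: "emeasure lebesgue (ball z d) \<le> 2 * emeasure lebesgue (B \<inter> ball z d)" using e2 d by blast
  define q where "q = 1 / (6 * d)"
  have q: "q > 0" "q * d = 1 / 6" using d by (auto simp: q_def)
  define v where "v = unit_ball_vol (real DIM('a))"
  have v: "v > 0" by (simp add: v_def)
  define V where "V = v * d ^ DIM('a)"
  define W where "W = v * q ^ DIM('a)"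
  have VW: "V > 0" "W > 0" using v d q by (auto simp: V_def W_def)
  have eV: "emeasure lebesgue (ball x d) = ennreal V" for x :: 'a
    unfolding V_def v_def by (rule emeasure_lebesgue_ball) (use d in simp)
  have eW: "emeasure lebesgue (ball x q) = ennreal W" for x :: 'a
    unfolding W_def v_def by (rule emeasure_lebesgue_ball) (use q in simp)
  \<comment> \<open>The position of \<open>E\<close> and the frequency \<open>x0\<close> are
    unrelated; only the radii \<open>r\<close> and \<open>s\<close> have to be dual.\<close>
  have transfer: "ennreal (measure lebesgue E / 2) * \<rho> (\<lambda>x. ennreal (w x) * indicator (ball x0 s) x)
      \<le> ennreal C * \<rho> (\<lambda>x. ennreal (w x) * indicator E x)"
    if E: "E \<in> sets lebesgue" "E \<subseteq> ball y0 r" "r \<ge> 0" "s * r = 1 / 6" for E y0 r x0 s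
  proof -
    define f where "f = (\<lambda>t. indicator E t * cis (2 * pi * (x0 \<bullet> t)))"
    have [measurable]: "E \<in> sets lebesgue" by fact
    have "emeasure lebesgue E < \<infinity>"
      using emeasure_mono[OF E(2), of lebesgue] emeasure_lebesgue_ball[OF E(3), of y0]
      by (auto simp: less_top[symmetric] top_unique)
    moreover have "f \<in> borel_measurable lebesgue" unfolding f_def by measurable
    ultimately have f: "integrable lebesgue f"
      by (intro integrable_bounded_on_finite_measure[OF E(1), where B=1])
         (auto simp: f_def norm_mult simp del: emeasure_completion split: split_indicator)
    note [measurable] = borel_measurable_fourier[OF f]
    have "ennreal (measure lebesgue E / 2) * \<rho> (\<lambda>x. ennreal (w x) * indicator (ball x0 s) x)
       = \<rho> (\<lambda>x. ennreal (measure lebesgue E / 2) * (ennreal (w x) * indicator (ball x0 s) x))"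
      by (subst cmult) (auto intro!: borel_measurable_times_ennreal borel_measurable_indicator)
    also have "\<dots> \<le> \<rho> (\<lambda>x. ennreal (w x * cmod (fourier f x)))"
    proof (rule mono)
      fix x
      show "ennreal (measure lebesgue E / 2) * (ennreal (w x) * indicator (ball x0 s) x) \<le> ennreal (w x * cmod (fourier f x))"
      proof (cases "x \<in> ball x0 s")
        case True
        then have "norm (x - x0) \<le> s" by (auto simp: dist_norm norm_minus_commute)
        then have "norm (x - x0) * r \<le> 1 / 6" using E(3,4) by (metis mult_right_mono)
        then have "measure lebesgue E / 2 \<le> cmod (fourier f x)"
          unfolding f_def by (rule fourier_modulated_indicator_ge[OF E(1,2)])
        then have "measure lebesgue E / 2 * w x \<le> w x * cmod (fourier f x)"
          using mult_right_mono[OF _ w(2)] by (subst (2) mult.commute)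
        then show ?thesis using True w(2)[of x] by (simp add: ennreal_mult[symmetric] ennreal_leI)
      qed simp
    qed (use f in \<open>auto intro!: borel_measurable_times_ennreal borel_measurable_indicator\<close>)
    also have "\<dots> \<le> ennreal C * \<rho> (\<lambda>x. ennreal (w x * cmod (f x)))" by (rule bound[OF f])
    also have "(\<lambda>x. ennreal (w x * cmod (f x))) = (\<lambda>x. ennreal (w x) * indicator E x)"
      by (auto simp: f_def norm_mult split: split_indicator)
    finally show ?thesis .
  qed
  define K where "K = A \<inter> ball y d"
  define L where "L = B \<inter> ball z d"
  have KL: "K \<in> sets lebesgue" "L \<in> sets lebesgue" by (auto simp: K_def L_def)
  have Kfin: "emeasure lebesgue K < \<infinity>" "emeasure lebesgue L < \<infinity>"
    using emeasure_mono[of K "ball y d" lebesgue] emeasure_mono[of L "ball z d" lebesgue] eV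
    by (auto simp: K_def L_def less_top[symmetric] top_unique simp del: emeasure_completion)
  have mK: "V / 2 \<le> measure lebesgue K" "V / 2 \<le> measure lebesgue L"
  proof -
    have "ennreal V \<le> ennreal (2 * measure lebesgue K)"
      using y Kfin unfolding eV K_def[symmetric]
      by (simp add: ennreal_mult emeasure_eq_ennreal_measure less_top[symmetric] del: emeasure_completion)
    moreover have "ennreal V \<le> ennreal (2 * measure lebesgue L)"
      using z Kfin unfolding eV L_def[symmetric]
      by (simp add: ennreal_mult emeasure_eq_ennreal_measure less_top[symmetric] del: emeasure_completion)
    ultimately show "V / 2 \<le> measure lebesgue K" "V / 2 \<le> measure lebesgue L" by auto
  qed
  have mKV: "measure lebesgue L \<le> V"
  proof -
    have "emeasure lebesgue L \<le> ennreal V" unfolding eV[of z, symmetric] by (rule emeasure_mono) (auto simp: L_def)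
    then show ?thesis using Kfin VW by (simp add: emeasure_eq_ennreal_measure less_top[symmetric] del: emeasure_completion)
  qed
  \<comment> \<open>The intermediate ball needs radius \<open>q\<close>; its centre \<open>y\<close>
    is an arbitrary choice.\<close>
  define X where "X = \<rho> (\<lambda>x. ennreal (w x) * indicator (ball y q) x)"
  define Y where "Y = \<rho> (\<lambda>x. ennreal (w x) * indicator (ball z d) x)"
  have 1: "ennreal (V / 4) * X \<le> ennreal C * ennreal (a * fund V)"
  proof -
    have "ennreal (V / 4) * X \<le> ennreal (measure lebesgue K / 2) * X"
      using mK by (intro mult_right_mono ennreal_leI) auto
    also have "\<dots> \<le> ennreal C * \<rho> (\<lambda>x. ennreal (w x) * indicator K x)"
      unfolding X_def using d q KL(1) by (intro transfer) (auto simp: K_def)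
    also have "\<rho> (\<lambda>x. ennreal (w x) * indicator K x) \<le> \<rho> (\<lambda>x. ennreal a * indicator (ball y d) x)"
      using KL by (intro mono borel_measurable_times_ennreal borel_measurable_indicator)
        (auto simp: K_def A_def ennreal_leI split: split_indicator)
    also have "\<dots> = ennreal (a * fund V)"
      using a rho_indicator[OF _ eV] VW fund_nonneg by (subst cmult) (auto simp: ennreal_mult intro!: borel_measurable_indicator)
    finally show ?thesis by (simp add: mult_left_mono)
  qed
  have 2: "ennreal (W / 2) * Y \<le> ennreal C * X"
  proof -
    have "measure lebesgue (ball y q) = W" using eW[of y] VW by (simp add: measure_def)
    then show ?thesis unfolding X_def Y_def using transfer[of "ball y q" y q d z] q by (simp add: mult.commute)
  qed
  \<comment> \<open>\<open>L\<close> fills at least half of \<open>ball z d\<close>, so the rest of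
    the ball contributes at most as much as \<open>L\<close>; this costs the factor 2.\<close>
  have 3: "ennreal (b / 2 * fund V) \<le> Y"
  proof -
    have VL: "measure lebesgue (ball z d - L) = V - measure lebesgue L"
      using eV[of z] VW Kfin KL by (subst measurable_measure_Diff) (auto simp: L_def fmeasurable_def measure_def)
    have "\<rho> (indicator (ball z d)) \<le> \<rho> (\<lambda>x. indicator L x + indicator (ball z d - L) x)"
      using KL by (intro mono borel_measurable_add borel_measurable_indicator) (auto split: split_indicator)
    also have "\<dots> \<le> \<rho> (indicator L) + \<rho> (indicator (ball z d - L))"
      using KL by (intro add_le borel_measurable_indicator) auto
    also have "\<rho> (indicator L) = ennreal (fund (measure lebesgue L))"
      using KL Kfin by (intro rho_indicator) (auto simp: emeasure_eq_ennreal_measure less_top[symmetric] simp del: emeasure_completion)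
    also have "\<rho> (indicator (ball z d - L)) = ennreal (fund (V - measure lebesgue L))"
    proof (rule rho_indicator)
      have "emeasure lebesgue (ball z d - L) \<le> ennreal V" unfolding eV[of z, symmetric] using KL by (intro emeasure_mono) auto
      then show "emeasure lebesgue (ball z d - L) = ennreal (V - measure lebesgue L)"
        unfolding VL[symmetric] by (intro emeasure_eq_ennreal_measure) (auto simp: top_unique)
    qed (use KL mKV in auto)
    also have "ennreal (fund (measure lebesgue L)) + ennreal (fund (V - measure lebesgue L)) \<le> ennreal (2 * fund (measure lebesgue L))"
    proof -
      have "fund (V - measure lebesgue L) \<le> fund (measure lebesgue L)" using mK mKV by (intro fund_mono) auto
      then show ?thesis using fund_nonneg by (simp add: ennreal_plus[symmetric] ennreal_leI del: ennreal_plus)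
    qed
    finally have "ennreal (fund V) \<le> ennreal (2 * fund (measure lebesgue L))"
      using rho_indicator[OF _ eV[of z]] VW by simp
    then have "fund V \<le> 2 * fund (measure lebesgue L)" using fund_nonneg by simp
    then have "ennreal (b / 2 * fund V) \<le> ennreal (b * fund (measure lebesgue L))"
      using b by (intro ennreal_leI) auto
    also have "\<dots> = ennreal b * \<rho> (indicator L)"
      using KL Kfin b fund_nonneg by (subst rho_indicator[where t="measure lebesgue L"])
        (auto simp: emeasure_eq_ennreal_measure less_top[symmetric] ennreal_mult simp del: emeasure_completion)
    also have "\<dots> = \<rho> (\<lambda>x. ennreal b * indicator L x)" using KL b by (subst cmult) auto
    also have "\<dots> \<le> Y" unfolding Y_def using KL
      by (intro mono borel_measurable_times_ennreal borel_measurable_indicator)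
        (auto simp: L_def B_def ennreal_leI split: split_indicator)
    finally show ?thesis .
  qed
  have "ennreal (V / 4 * (W / 2 * (b / 2 * fund V))) = ennreal (V / 4) * (ennreal (W / 2) * ennreal (b / 2 * fund V))"
    using VW b(1) fund_nonneg by (simp add: ennreal_mult[symmetric])
  also have "\<dots> \<le> ennreal (V / 4) * (ennreal (W / 2) * Y)" using 3 by (intro mult_left_mono) auto
  also have "\<dots> \<le> ennreal (V / 4) * (ennreal C * X)" using 2 by (intro mult_left_mono) auto
  also have "\<dots> = ennreal C * (ennreal (V / 4) * X)" by (simp add: mult_ac)
  also have "\<dots> \<le> ennreal C * (ennreal C * ennreal (a * fund V))" using 1 by (intro mult_left_mono) auto
  also have "\<dots> = ennreal (C * (C * (a * fund V)))" using C a(1) fund_nonneg by (simp add: ennreal_mult[symmetric])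
  finally have "V / 4 * (W / 2 * (b / 2 * fund V)) \<le> C * (C * (a * fund V))"
    using C a fund_nonneg by (subst (asm) ennreal_le_iff) auto
  then have "(V * W * b) * fund V \<le> (16 * C\<^sup>2 * a) * fund V" by (simp add: power2_eq_square mult_ac)
  then have "V * W * b \<le> 16 * C\<^sup>2 * a" using fund_pos[OF VW(1)] by simp
  \<comment> \<open>The scale \<open>d\<close> cancels here, so the constant is uniform although
    \<open>d\<close> depends on the sets and hence on \<open>a\<close> and \<open>b\<close>.\<close>
  moreover have "V * W = v\<^sup>2 / 6 ^ DIM('a)"
  proof -
    have "V * W = v\<^sup>2 * (q * d) ^ DIM('a)" by (simp add: V_def W_def power2_eq_square power_mult_distrib mult_ac)
    then show ?thesis by (simp add: q power_divide)
  qed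
  ultimately show ?thesis using v unfolding v_def[symmetric] by (simp add: field_simps)
qed

text \<open>One level \<open>b\<close> with \<open>{x. w x \<ge> b}\<close> non-null bounds the
  essential infimum from below, and one level \<open>a\<close> with \<open>{x. w x \<le> a}\<close>
  non-null bounds the essential supremum from above. Such levels exist because \<open>w\<close> is
  finite and not almost everywhere zero.\<close>

lemma (in ri_function_norm) weight_bounds:
  fixes w :: "'a \<Rightarrow> real"
  assumes w: "w \<in> borel_measurable lebesgue" "\<And>x. w x \<ge> 0" "\<not> (AE x in lebesgue. w x = 0)"
    and C: "C > 0"
    and bound: "\<And>f. integrable lebesgue f \<Longrightarrow>
      \<rho> (\<lambda>x. ennreal (w x * cmod (fourier f x))) \<le> ennreal C * \<rho> (\<lambda>x. ennreal (w x * cmod (f x)))"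
  obtains m M where "0 < m" "0 < M" "AE x in lebesgue. m \<le> w x \<and> w x \<le> M"
proof -
  define K where "K = 16 * 6 ^ DIM('a) * C\<^sup>2 / (unit_ball_vol DIM('a))\<^sup>2"
  have K: "K > 0" unfolding K_def using C by (intro divide_pos_pos mult_pos_pos zero_less_power unit_ball_vol_pos) auto
  note [measurable] = w(1)
  have le_sets: "{x. w x \<le> c} \<in> sets lebesgue" "{x. w x \<ge> c} \<in> sets lebesgue" for c
    using borel_measurable_le[OF w(1), of "\<lambda>_. c"] borel_measurable_le[OF _ w(1), of "\<lambda>_. c"] by auto
  have osc: "b \<le> K * a" if "a > 0" "emeasure lebesgue {x. w x \<le> a} > 0" "b > 0" "emeasure lebesgue {x. w x \<ge> b} > 0" for a b
    unfolding K_def by (rule weight_oscillation[OF w(1,2) C bound that])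
  have "\<exists>n::nat. emeasure lebesgue {x. w x \<ge> 1 / Suc n} > 0"
  proof (rule ccontr)
    assume "\<not> ?thesis"
    then have "(\<Union>n::nat. {x. w x \<ge> 1 / Suc n}) \<in> null_sets lebesgue"
      using le_sets by (intro null_sets_UN) (auto simp: null_sets_def)
    then have "AE x in lebesgue. x \<notin> (\<Union>n::nat. {x. w x \<ge> 1 / Suc n})" by (rule AE_not_in)
    then have "AE x in lebesgue. w x = 0"
    proof eventually_elim
      case (elim x)
      then have "w x < 1 / Suc n" for n using not_le by auto
      then have "\<not> 0 < w x" by (meson nat_approx_posE order_less_asym)
      then show ?case using w(2)[of x] by simp
    qed
    with w(3) show False by blast
  qed
  then obtain n :: nat where "emeasure lebesgue {x. w x \<ge> 1 / Suc n} > 0" by blast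
  then obtain b where b: "b > 0" "emeasure lebesgue {x. w x \<ge> b} > 0" by (intro that[of "1 / Suc n"]) auto
  have "\<exists>n::nat. emeasure lebesgue {x. w x \<le> Suc n} > 0"
  proof (rule ccontr)
    assume "\<not> ?thesis"
    then have "(\<Union>n::nat. {x. w x \<le> Suc n}) \<in> null_sets lebesgue"
      using le_sets by (intro null_sets_UN) (auto simp: null_sets_def)
    moreover have "(\<Union>n::nat. {x. w x \<le> Suc n}) = UNIV"
    proof -
      have "\<exists>n::nat. w x \<le> Suc n" for x using real_arch_simple[of "w x"] by (metis le_SucI of_nat_le_iff order_trans le_refl)
      then show ?thesis by auto
    qed
    ultimately have "AE x in lebesgue. False" using AE_not_in by fastforce
    then have "AE x in lebesgue. w x = 0" by (rule eventually_mono) simp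
    with w(3) show False by blast
  qed
  then obtain n :: nat where "emeasure lebesgue {x. w x \<le> Suc n} > 0" by blast
  then obtain a where a: "a > 0" "emeasure lebesgue {x. w x \<le> a} > 0" by (metis of_nat_0_less_iff zero_less_Suc)
  \<comment> \<open>The factors 2 here and in \<open>M\<close> make the contradiction with
    \<open>osc\<close> strict.\<close>
  define m where "m = b / (2 * K)"
  define M where "M = 2 * K * a"
  have mM: "m > 0" "M > 0" using a b K by (auto simp: m_def M_def)
  have "K * m < b" using b K by (simp add: m_def)
  then have "\<not> emeasure lebesgue {x. w x \<le> m} > 0" using osc[OF mM(1) _ b] by fastforce
  then have "{x. w x \<le> m} \<in> null_sets lebesgue" using le_sets by (auto simp: null_sets_def)
  then have 1: "AE x in lebesgue. x \<notin> {x. w x \<le> m}" by (rule AE_not_in)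
  have "K * a < M" using a K by (simp add: M_def)
  then have "\<not> emeasure lebesgue {x. w x \<ge> M} > 0" using osc[OF a mM(2)] by fastforce
  then have "{x. w x \<ge> M} \<in> null_sets lebesgue" using le_sets by (auto simp: null_sets_def)
  then have 2: "AE x in lebesgue. x \<notin> {x. w x \<ge> M}" by (rule AE_not_in)
  have "AE x in lebesgue. m \<le> w x \<and> w x \<le> M" using 1 2 by eventually_elim auto
  with mM show ?thesis by (rule that)
qed

section \<open>Removal of the weight and conclusion\<close>

theorem theorem2p5:
  fixes \<rho> :: "('a::euclidean_space \<Rightarrow> ennreal) \<Rightarrow> ennreal"
    and w :: "'a \<Rightarrow> real"
    and C :: real
  assumes "ri_norm \<rho>"
    and "w \<in> borel_measurable lebesgue"
    and "\<forall>x. w x \<ge> 0"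
    and "\<not> (AE x in lebesgue. w x = 0)"
    and "C > 0"
    and "\<forall>f :: 'a \<Rightarrow> complex. integrable lebesgue f \<and>
            (\<lambda>x. complex_of_real (w x) * f x) \<in> ri_space \<rho> \<longrightarrow>
            (\<lambda>x. complex_of_real (w x) * fourier f x) \<in> ri_space \<rho> \<and>
            ri_fnorm \<rho> (\<lambda>x. complex_of_real (w x) * fourier f x)
              \<le> ennreal C * ri_fnorm \<rho> (\<lambda>x. complex_of_real (w x) * f x)"
  shows "(\<exists>m M. 0 < m \<and> 0 < M \<and> (AE x in lebesgue. m \<le> w x \<and> w x \<le> M)) \<and>
         ri_space \<rho> = L2_space \<and>
         (\<exists>c1 c2. 0 < c1 \<and> 0 < c2 \<and>
            (\<forall>f \<in> L2_space. c1 * L2_norm f \<le> enn2real (ri_fnorm \<rho> f) \<and>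
                             enn2real (ri_fnorm \<rho> f) \<le> c2 * L2_norm f))"
proof -
  interpret ri_function_norm \<rho> by standard fact
  have w0: "w x \<ge> 0" for x using assms(3) by blast
  have [measurable]: "w \<in> borel_measurable lebesgue" by fact
  have wf: "ri_fnorm \<rho> (\<lambda>x. complex_of_real (w x) * f x) = \<rho> (\<lambda>x. ennreal (w x * cmod (f x)))" for f
    using w0 by (simp add: ri_fnorm_def norm_mult)
  have bound: "\<rho> (\<lambda>x. ennreal (w x * cmod (fourier f x))) \<le> ennreal C * \<rho> (\<lambda>x. ennreal (w x * cmod (f x)))"
    if f: "integrable lebesgue f" for f
  proof (cases "\<rho> (\<lambda>x. ennreal (w x * cmod (f x))) < \<infinity>")
    case True
    have [measurable]: "f \<in> borel_measurable lebesgue" using f by auto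
    have "(\<lambda>x. complex_of_real (w x) * f x) \<in> borel_measurable lebesgue" by measurable
    then have "(\<lambda>x. complex_of_real (w x) * f x) \<in> ri_space \<rho>" using True by (simp add: ri_space_def wf)
    then show ?thesis using assms(6) f unfolding wf by blast
  next
    case False
    then have "\<rho> (\<lambda>x. ennreal (w x * cmod (f x))) = top" by (simp add: less_top[symmetric])
    then show ?thesis using assms(5) by (simp add: ennreal_mult_top)
  qed
  obtain m M where mM: "0 < m" "0 < M" "AE x in lebesgue. m \<le> w x \<and> w x \<le> M"
    using weight_bounds[OF assms(2) w0 assms(4,5) bound] by blast
  \<comment> \<open>The lower bound \<open>m\<close> is spent on the transform and the upper bound
    \<open>M\<close> on the function, which gives the constant \<open>C * M / m\<close>.\<close>
  interpret fourier_bounded \<rho> "C * M / m"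
  proof
    show "C * M / m > 0" using mM assms(5) by simp
    fix f :: "'a \<Rightarrow> complex" assume f: "integrable lebesgue f"
    have [measurable]: "f \<in> borel_measurable lebesgue" "fourier f \<in> borel_measurable lebesgue"
      using f by (auto intro: borel_measurable_fourier)
    have "ennreal m * \<rho> (\<lambda>x. ennreal (cmod (fourier f x))) = \<rho> (\<lambda>x. ennreal m * ennreal (cmod (fourier f x)))"
      using mM by (subst cmult) auto
    also have "\<dots> \<le> \<rho> (\<lambda>x. ennreal (w x * cmod (fourier f x)))"
    proof (rule mono_AE)
      show "AE x in lebesgue. ennreal m * ennreal (cmod (fourier f x)) \<le> ennreal (w x * cmod (fourier f x))"
        using mM(3) by eventually_elim (use mM in \<open>auto simp: ennreal_mult[symmetric] intro!: ennreal_leI mult_right_mono\<close>)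
    qed measurable
    also have "\<dots> \<le> ennreal C * \<rho> (\<lambda>x. ennreal (w x * cmod (f x)))" by (rule bound[OF f])
    also have "\<rho> (\<lambda>x. ennreal (w x * cmod (f x))) \<le> \<rho> (\<lambda>x. ennreal M * ennreal (cmod (f x)))"
    proof (rule mono_AE)
      show "AE x in lebesgue. ennreal (w x * cmod (f x)) \<le> ennreal M * ennreal (cmod (f x))"
        using mM(3) by eventually_elim (use mM in \<open>auto simp: ennreal_mult[symmetric] intro!: ennreal_leI mult_right_mono\<close>)
    qed measurable
    also have "\<dots> = ennreal M * \<rho> (\<lambda>x. ennreal (cmod (f x)))" using mM by (subst cmult) auto
    finally have "ennreal m * \<rho> (\<lambda>x. ennreal (cmod (fourier f x))) \<le> ennreal C * (ennreal M * \<rho> (\<lambda>x. ennreal (cmod (f x))))"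
      by (simp add: mult_left_mono)
    also have "\<dots> = ennreal m * (ennreal (C * M / m) * \<rho> (\<lambda>x. ennreal (cmod (f x))))"
      using mM assms(5) by (simp add: mult.assoc[symmetric] ennreal_mult[symmetric])
    finally show "\<rho> (\<lambda>x. ennreal (cmod (fourier f x))) \<le> ennreal (C * M / m) * \<rho> (\<lambda>x. ennreal (cmod (f x)))"
      using mM by (subst (asm) ennreal_mult_le_mult_iff) auto
  qed
  obtain c1 c2 where c: "c1 > 0" "c2 > 0" "\<And>F. F \<in> borel_measurable lebesgue \<Longrightarrow> L2_comparable c1 c2 F"
    using L2_comparable_measurable by blast
  have cmp: "L2_comparable c1 c2 (\<lambda>x. ennreal (cmod (f x)))" if "f \<in> borel_measurable lebesgue" for f
    using that by (intro c) measurable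
  have L2: "f \<in> L2_space \<longleftrightarrow> f \<in> borel_measurable lebesgue \<and> (\<integral>\<^sup>+x. (ennreal (cmod (f x)))\<^sup>2 \<partial>lebesgue) < \<infinity>" for f :: "'a \<Rightarrow> complex"
    by (auto simp: L2_space_def integrable_iff_bounded ennreal_power)
  have nn: "(\<integral>\<^sup>+x. (ennreal (cmod (f x)))\<^sup>2 \<partial>lebesgue) = ennreal ((L2_norm f)\<^sup>2)" "L2_norm f \<ge> 0" if "f \<in> L2_space" for f :: "'a \<Rightarrow> complex"
    using that by (auto simp: L2_space_def L2_norm_def ennreal_power nn_integral_eq_integral)
  have upper: "ri_fnorm \<rho> f \<le> ennreal (c2 * L2_norm f)" if "f \<in> L2_space" for f
    using cmp[of f] nn[OF that] that unfolding L2_comparable_def ri_fnorm_def L2 by auto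
  have space: "ri_space \<rho> = L2_space"
  proof (intro set_eqI iffI)
    fix f assume f: "f \<in> ri_space \<rho>"
    then have fm: "f \<in> borel_measurable lebesgue" and "\<rho> (\<lambda>x. ennreal (cmod (f x))) < \<infinity>"
      by (auto simp: ri_space_def ri_fnorm_def)
    then obtain R where R: "R \<ge> 0" "\<rho> (\<lambda>x. ennreal (cmod (f x))) = ennreal R"
      by (cases "\<rho> (\<lambda>x. ennreal (cmod (f x)))") auto
    then have "(\<integral>\<^sup>+x. (ennreal (cmod (f x)))\<^sup>2 \<partial>lebesgue) \<le> ennreal ((c1 * R)\<^sup>2)"
      using cmp[OF fm] unfolding L2_comparable_def by simp
    then show "f \<in> L2_space" using fm unfolding L2 by (auto simp: le_less_trans less_top[symmetric] top_unique)
  next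
    fix f :: "'a \<Rightarrow> complex" assume "f \<in> L2_space"
    then show "f \<in> ri_space \<rho>" using upper[of f] L2[of f] by (auto simp: ri_space_def le_less_trans)
  qed
  \<comment> \<open>In \<open>L2_comparable\<close> the constant \<open>c1\<close> multiplies the
    norm in \<open>X\<close>, hence the reciprocal.\<close>
  have "1 / c1 * L2_norm f \<le> enn2real (ri_fnorm \<rho> f) \<and> enn2real (ri_fnorm \<rho> f) \<le> c2 * L2_norm f"
    if f: "f \<in> L2_space" for f
  proof
    have fm: "f \<in> borel_measurable lebesgue" and fin: "ri_fnorm \<rho> f < \<infinity>"
      using f space by (auto simp: ri_space_def)
    define R where "R = enn2real (ri_fnorm \<rho> f)"
    have R: "R \<ge> 0" "ri_fnorm \<rho> f = ennreal R" using fin by (auto simp: R_def)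
    then have "ennreal ((L2_norm f)\<^sup>2) \<le> ennreal ((c1 * R)\<^sup>2)"
      using cmp[OF fm] unfolding L2_comparable_def ri_fnorm_def nn(1)[OF f] by simp
    then have "(L2_norm f)\<^sup>2 \<le> (c1 * R)\<^sup>2" by simp
    then have "L2_norm f \<le> c1 * R" by (rule power2_le_imp_le) (use c(1) R(1) in simp)
    then show "1 / c1 * L2_norm f \<le> enn2real (ri_fnorm \<rho> f)" unfolding R_def[symmetric] using c(1) by (simp add: pos_divide_le_eq mult.commute)
    show "enn2real (ri_fnorm \<rho> f) \<le> c2 * L2_norm f"
    proof -
      have "0 \<le> c2 * L2_norm f" using c(2) nn(2)[OF f] by simp
      then show ?thesis using upper[OF f] R(1) unfolding R(2) by simp
    qed
  qed
  then have "\<exists>c1 c2. 0 < c1 \<and> 0 < c2 \<and> (\<forall>f \<in> L2_space. c1 * L2_norm f \<le> enn2real (ri_fnorm \<rho> f) \<and>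
      enn2real (ri_fnorm \<rho> f) \<le> c2 * L2_norm f)"
    using c(1,2) by (intro exI[of _ "1 / c1"] exI[of _ c2]) simp
  with mM space show ?thesis by blast
qed

end
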